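(* Let $R$ be a ring and let $M$ be a left $R$-module which is a progenerator in $\sigma[M]$, and suppose $M$ is a semiprime Goldie module. If $A\in\sigma[M]$ is non $M$-singular and quasi-injective, then $A$ is $M$-injective.
   Context: Rings are associative with unit and modules are left unital modules. $\sigma[M]$ is the full subcategory of $R$-Mod of $M$-subgenerated modules (submodules of quotients of direct sums of copies of $M$). "Projective in $\sigma[M]$" means that $\mathrm{Hom}_R(M,-)$ is exact on short exact sequences in $\sigma[M]$; "generator in $\sigma[M]$" means every module in $\sigma[M]$ is a quotient of a direct sum of copies of $M$; a progenerator in $\sigma[M]$ is a finitely generated module that is projective in $\sigma[M]$ and a generator in $\sigma[M]$. A module $A$ is $X$-injective if every homomorphism from a submodule of $X$ to $A$ extends to $X$; $A$ is quasi-injective if it is $A$-injective. A module $X\in\sigma[M]$ is $M$-singular if there is an exact sequence $0\to K\to L\to X\to 0$ in $\sigma[M]$ with $K$ essential in $L$; every $N\in\sigma[M]$ has a largest $M$-singular submodule $\mathcal{Z}(N)$, and $N$ is non $M$-singular if $\mathcal{Z}(N)=0$. A submodule $N\le M$ is fully invariant, $N\leq_{FI}M$, if $f(N)\le N$ for all $f\in \mathrm{End}_R(M)$. For $N,K\le M$, the product is $N_MK=\sum\{f(N)\mid f\in \mathrm{Hom}_R(M,K)\}$. $M$ is semiprime if whenever $K\leq_{FI}M$ and $K_MK=0$, then $K=0$. A left annihilator in $M$ is a submodule of the form $\bigcap_{f\in X}\mathrm{Ker}(f)$ for some $X\subseteq \mathrm{End}_R(M)$. $M$ is a Goldie module if it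 satisfies ACC on left annihilators and has finite uniform dimension. *)

theory Defs
  imports "HOL-Algebra.Module"
begin

section \<open>Left modules over a not necessarily commutative ring\<close>

(* The locale module of HOL-Algebra requires a commutative ring; its record type and its locale
   submodule do not, and both are reused. *)
locale left_module = R?: ring R + M?: abelian_group M
  for R :: "('r, 'e) ring_scheme" (structure) and M :: "('r, 'm) module" (structure) +
  assumes smult_closed [simp, intro]:
      "\<lbrakk>a \<in> carrier R; x \<in> carrier M\<rbrakk> \<Longrightarrow> a \<odot>\<^bsub>M\<^esub> x \<in> carrier M"
    and smult_l_distr:
      "\<lbrakk>a \<in> carrier R; b \<in> carrier R; x \<in> carrier M\<rbrakk> \<Longrightarrow>
      (a \<oplus> b) \<odot>\<^bsub>M\<^esub> x = a \<odot>\<^bsub>M\<^esub> x \<oplus>\<^bsub>M\<^esub> b \<odot>\<^bsub>M\<^esub> x"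
    and smult_r_distr:
      "\<lbrakk>a \<in> carrier R; x \<in> carrier M; y \<in> carrier M\<rbrakk> \<Longrightarrow>
      a \<odot>\<^bsub>M\<^esub> (x \<oplus>\<^bsub>M\<^esub> y) = a \<odot>\<^bsub>M\<^esub> x \<oplus>\<^bsub>M\<^esub> a \<odot>\<^bsub>M\<^esub> y"
    and smult_assoc1:
      "\<lbrakk>a \<in> carrier R; b \<in> carrier R; x \<in> carrier M\<rbrakk> \<Longrightarrow>
      (a \<otimes> b) \<odot>\<^bsub>M\<^esub> x = a \<odot>\<^bsub>M\<^esub> (b \<odot>\<^bsub>M\<^esub> x)"
    and smult_one [simp]:
      "x \<in> carrier M \<Longrightarrow> \<one> \<odot>\<^bsub>M\<^esub> x = x"

abbreviation submod :: "('r, 'm) module \<Rightarrow> 'm set \<Rightarrow> ('r, 'm) module"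
  where "submod M N \<equiv> M\<lparr>carrier := N\<rparr>"

(* Homomorphisms are extensional, i.e. undefined outside the carrier of the domain. *)
definition mod_hom :: "('r, 'e) ring_scheme \<Rightarrow> ('r, 'm) module \<Rightarrow> ('r, 'n) module \<Rightarrow> ('m \<Rightarrow> 'n) set"
  where "mod_hom R M N = {f \<in> carrier M \<rightarrow>\<^sub>E carrier N.
    (\<forall>x\<in>carrier M. \<forall>y\<in>carrier M. f (x \<oplus>\<^bsub>M\<^esub> y) = f x \<oplus>\<^bsub>N\<^esub> f y) \<and>
    (\<forall>r\<in>carrier R. \<forall>x\<in>carrier M. f (r \<odot>\<^bsub>M\<^esub> x) = r \<odot>\<^bsub>N\<^esub> f x)}"

definition mod_ker :: "('r, 'm) module \<Rightarrow> ('r, 'n) module \<Rightarrow> ('m \<Rightarrow> 'n) \<Rightarrow> 'm set"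
  where "mod_ker M N f = {x \<in> carrier M. f x = \<zero>\<^bsub>N\<^esub>}"

definition mod_span :: "('r, 'e) ring_scheme \<Rightarrow> ('r, 'm) module \<Rightarrow> 'm set \<Rightarrow> 'm set"
  where "mod_span R M S = \<Inter>{H. submodule H R M \<and> S \<subseteq> H}"

definition submod_sum :: "('r, 'e) ring_scheme \<Rightarrow> ('r, 'm) module \<Rightarrow> 'm set set \<Rightarrow> 'm set"
  where "submod_sum R M F = mod_span R M (\<Union>F)"

definition fin_gen :: "('r, 'e) ring_scheme \<Rightarrow> ('r, 'm) module \<Rightarrow> bool"
  where "fin_gen R M \<longleftrightarrow> (\<exists>S. finite S \<and> S \<subseteq> carrier M \<and> mod_span R M S = carrier M)"

definition essential :: "('r, 'e) ring_scheme \<Rightarrow> ('r, 'm) module \<Rightarrow> 'm set \<Rightarrow> bool"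
  where "essential R M K \<longleftrightarrow> submodule K R M \<and>
    (\<forall>U. submodule U R M \<and> K \<inter> U = {\<zero>\<^bsub>M\<^esub>} \<longrightarrow> U = {\<zero>\<^bsub>M\<^esub>})"

definition short_exact :: "('r, 'e) ring_scheme \<Rightarrow> ('r, 'k) module \<Rightarrow> ('k \<Rightarrow> 'l) \<Rightarrow>
    ('r, 'l) module \<Rightarrow> ('l \<Rightarrow> 'x) \<Rightarrow> ('r, 'x) module \<Rightarrow> bool"
  where "short_exact R K i L p X \<longleftrightarrow>
    left_module R K \<and> left_module R L \<and> left_module R X \<and>
    i \<in> mod_hom R K L \<and> inj_on i (carrier K) \<and>
    p \<in> mod_hom R L X \<and> p ` carrier L = carrier X \<and>
    i ` carrier K = mod_ker L X p"

definition direct_power :: "'i set \<Rightarrow> ('r, 'm) module \<Rightarrow> ('r, 'i \<Rightarrow> 'm) module"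
  where "direct_power I M =
    \<lparr>carrier = {f \<in> I \<rightarrow>\<^sub>E carrier M. finite {i \<in> I. f i \<noteq> \<zero>\<^bsub>M\<^esub>}},
     mult = undefined, one = undefined,
     zero = (\<lambda>i\<in>I. \<zero>\<^bsub>M\<^esub>),
     add = (\<lambda>f g. \<lambda>i\<in>I. f i \<oplus>\<^bsub>M\<^esub> g i),
     smult = (\<lambda>r f. \<lambda>i\<in>I. r \<odot>\<^bsub>M\<^esub> f i)\<rparr>"


section \<open>The category of M-subgenerated modules\<close>

(* HOL has no quantification over types, so wherever the mathematics ranges over all modules or all
   index sets, a type large enough for that purpose is used:
     - index sets of the direct sums mapping onto (a module containing) N :: ('r, 'n) module
       are subsets of 'n \<times> nat: each element of N involves finitely many summands only;
     - the modules tested against, or produced from, X :: ('r, 'x) module have carriers in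
       ('r \<times> 'x) list: this type is at least as large as any module generated by a family
       indexed by the elements of X.
   That nothing is lost is proved in the last section: in_sigma_any, projective_any,
   generator_any and M_singular_any state the respective properties for arbitrary types. *)

type_synonym ('r, 'x) gen = "('r \<times> 'x) list"

(* N embeds in a quotient Q of a direct sum of copies of M. A quotient of a module with carrier type
   't has a copy of type 't set. *)
definition in_sigma :: "('r, 'e) ring_scheme \<Rightarrow> ('r, 'm) module \<Rightarrow> ('r, 'n) module \<Rightarrow> bool"
  where "in_sigma R M N \<longleftrightarrow> left_module R N \<and>
    (\<exists>(I :: ('n \<times> nat) set) (Q :: ('r, ('n \<times> nat \<Rightarrow> 'm) set) module) p j.
      left_module R Q \<and>
      p \<in> mod_hom R (direct_power I M) Q \<and> p ` carrier (direct_power I M) = carrier Q \<and>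
      j \<in> mod_hom R N Q \<and> inj_on j (carrier N))"

(* Exactness of 0 \<rightarrow> Hom(M,K) \<rightarrow> Hom(M,L) \<rightarrow> Hom(M,X) \<rightarrow> 0. *)
definition hom_exact :: "('r, 'e) ring_scheme \<Rightarrow> ('r, 'm) module \<Rightarrow> ('r, 'k) module \<Rightarrow>
    ('k \<Rightarrow> 'l) \<Rightarrow> ('r, 'l) module \<Rightarrow> ('l \<Rightarrow> 'x) \<Rightarrow> ('r, 'x) module \<Rightarrow> bool"
  where "hom_exact R M K i L p X \<longleftrightarrow>
    inj_on (compose (carrier M) i) (mod_hom R M K) \<and>
    compose (carrier M) i ` mod_hom R M K
      = {g \<in> mod_hom R M L. compose (carrier M) p g = (\<lambda>m\<in>carrier M. \<zero>\<^bsub>X\<^esub>)} \<and>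
    compose (carrier M) p ` mod_hom R M L = mod_hom R M X"

definition projective_in_sigma :: "('r, 'e) ring_scheme \<Rightarrow> ('r, 'm) module \<Rightarrow> bool"
  where "projective_in_sigma R M \<longleftrightarrow>
    (\<forall>(K :: ('r, ('r, 'm) gen) module) i (L :: ('r, ('r, 'm) gen) module) p
      (X :: ('r, ('r, 'm) gen) module).
      in_sigma R M K \<and> in_sigma R M L \<and> in_sigma R M X \<and> short_exact R K i L p X
      \<longrightarrow> hom_exact R M K i L p X)"

definition generator_in_sigma :: "('r, 'e) ring_scheme \<Rightarrow> ('r, 'm) module \<Rightarrow> bool"
  where "generator_in_sigma R M \<longleftrightarrow>
    (\<forall>N :: ('r, ('r, 'm) gen) module. in_sigma R M N \<longrightarrow>
      (\<exists>(I :: (('r, 'm) gen \<times> nat) set) p. p \<in> mod_hom R (direct_power I M) N \<and>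
        p ` carrier (direct_power I M) = carrier N))"

definition progenerator_in_sigma :: "('r, 'e) ring_scheme \<Rightarrow> ('r, 'm) module \<Rightarrow> bool"
  where "progenerator_in_sigma R M \<longleftrightarrow>
    fin_gen R M \<and> projective_in_sigma R M \<and> generator_in_sigma R M"


section \<open>Injectivity and singularity\<close>

definition rel_injective :: "('r, 'e) ring_scheme \<Rightarrow> ('r, 'x) module \<Rightarrow> ('r, 'a) module \<Rightarrow> bool"
  where "rel_injective R X A \<longleftrightarrow>
    (\<forall>U f. submodule U R X \<and> f \<in> mod_hom R (submod X U) A \<longrightarrow>
      (\<exists>g \<in> mod_hom R X A. \<forall>u\<in>U. g u = f u))"

definition quasi_injective :: "('r, 'e) ring_scheme \<Rightarrow> ('r, 'a) module \<Rightarrow> bool"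
  where "quasi_injective R A \<longleftrightarrow> rel_injective R A A"

definition M_singular :: "('r, 'e) ring_scheme \<Rightarrow> ('r, 'm) module \<Rightarrow> ('r, 'x) module \<Rightarrow> bool"
  where "M_singular R M X \<longleftrightarrow> in_sigma R M X \<and>
    (\<exists>(K :: ('r, ('r, 'x) gen) module) i (L :: ('r, ('r, 'x) gen) module) p.
      in_sigma R M K \<and> in_sigma R M L \<and> short_exact R K i L p X \<and>
      essential R L (i ` carrier K))"

(* The sum of all M-singular submodules. It coincides with the largest M-singular submodule
   (left_module.singular_part_eqI below). *)
definition singular_part :: "('r, 'e) ring_scheme \<Rightarrow> ('r, 'm) module \<Rightarrow> ('r, 'n) module \<Rightarrow> 'n set"
  where "singular_part R M N =
    submod_sum R N {K. submodule K R N \<and> M_singular R M (submod N K)}"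

definition non_M_singular :: "('r, 'e) ring_scheme \<Rightarrow> ('r, 'm) module \<Rightarrow> ('r, 'n) module \<Rightarrow> bool"
  where "non_M_singular R M N \<longleftrightarrow> singular_part R M N = {\<zero>\<^bsub>N\<^esub>}"


section \<open>Semiprime and Goldie modules\<close>

definition fully_invariant :: "('r, 'e) ring_scheme \<Rightarrow> ('r, 'm) module \<Rightarrow> 'm set \<Rightarrow> bool"
  where "fully_invariant R M N \<longleftrightarrow> submodule N R M \<and> (\<forall>f \<in> mod_hom R M M. f ` N \<subseteq> N)"

definition submod_prod :: "('r, 'e) ring_scheme \<Rightarrow> ('r, 'm) module \<Rightarrow> 'm set \<Rightarrow> 'm set \<Rightarrow> 'm set"
  where "submod_prod R M N K = submod_sum R M {f ` N | f. f \<in> mod_hom R M (submod M K)}"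

definition semiprime_module :: "('r, 'e) ring_scheme \<Rightarrow> ('r, 'm) module \<Rightarrow> bool"
  where "semiprime_module R M \<longleftrightarrow>
    (\<forall>K. fully_invariant R M K \<and> submod_prod R M K K = {\<zero>\<^bsub>M\<^esub>} \<longrightarrow> K = {\<zero>\<^bsub>M\<^esub>})"

(* The explicit carrier covers X = {}, whose annihilator is M. *)
definition left_annihilator :: "('r, 'e) ring_scheme \<Rightarrow> ('r, 'm) module \<Rightarrow> 'm set \<Rightarrow> bool"
  where "left_annihilator R M N \<longleftrightarrow>
    (\<exists>X \<subseteq> mod_hom R M M. N = carrier M \<inter> (\<Inter>f\<in>X. mod_ker M M f))"

definition acc_left_annihilators :: "('r, 'e) ring_scheme \<Rightarrow> ('r, 'm) module \<Rightarrow> bool"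
  where "acc_left_annihilators R M \<longleftrightarrow>
    (\<forall>C :: nat \<Rightarrow> 'm set. (\<forall>k. left_annihilator R M (C k) \<and> C k \<subseteq> C (Suc k)) \<longrightarrow>
      (\<exists>n. \<forall>k\<ge>n. C k = C n))"

definition uniform_submodule :: "('r, 'e) ring_scheme \<Rightarrow> ('r, 'm) module \<Rightarrow> 'm set \<Rightarrow> bool"
  where "uniform_submodule R M U \<longleftrightarrow> submodule U R M \<and> U \<noteq> {\<zero>\<^bsub>M\<^esub>} \<and>
    (\<forall>V W. submodule V R M \<and> submodule W R M \<and> V \<subseteq> U \<and> W \<subseteq> U \<and>
      V \<noteq> {\<zero>\<^bsub>M\<^esub>} \<and> W \<noteq> {\<zero>\<^bsub>M\<^esub>} \<longrightarrow> V \<inter> W \<noteq> {\<zero>\<^bsub>M\<^esub>})"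

definition independent_family ::
    "('r, 'e) ring_scheme \<Rightarrow> ('r, 'm) module \<Rightarrow> 'i set \<Rightarrow> ('i \<Rightarrow> 'm set) \<Rightarrow> bool"
  where "independent_family R M I U \<longleftrightarrow>
    (\<forall>i\<in>I. submodule (U i) R M \<and> U i \<inter> submod_sum R M (U ` (I - {i})) = {\<zero>\<^bsub>M\<^esub>})"

(* A direct sum of n uniform submodules is essential in M. *)
definition has_uniform_dim :: "('r, 'e) ring_scheme \<Rightarrow> ('r, 'm) module \<Rightarrow> nat \<Rightarrow> bool"
  where "has_uniform_dim R M n \<longleftrightarrow>
    (\<exists>U. (\<forall>i<n. uniform_submodule R M (U i)) \<and> independent_family R M {..<n} U \<and>
      essential R M (submod_sum R M (U ` {..<n})))"

definition goldie_module :: "('r, 'e) ring_scheme \<Rightarrow> ('r, 'm) module \<Rightarrow> bool"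
  where "goldie_module R M \<longleftrightarrow> acc_left_annihilators R M \<and> (\<exists>n. has_uniform_dim R M n)"

section \<open>Independence of the chosen carrier and index types\<close>

lemma left_moduleI:
  assumes "ring R" "abelian_group M"
    and "\<And>a x. a \<in> carrier R \<Longrightarrow> x \<in> carrier M \<Longrightarrow> a \<odot>\<^bsub>M\<^esub> x \<in> carrier M"
    and "\<And>a b x. a \<in> carrier R \<Longrightarrow> b \<in> carrier R \<Longrightarrow> x \<in> carrier M \<Longrightarrow>
      (a \<oplus>\<^bsub>R\<^esub> b) \<odot>\<^bsub>M\<^esub> x = a \<odot>\<^bsub>M\<^esub> x \<oplus>\<^bsub>M\<^esub> b \<odot>\<^bsub>M\<^esub> x"
    and "\<And>a x y. a \<in> carrier R \<Longrightarrow> x \<in> carrier M \<Longrightarrow> y \<in> carrier M \<Longrightarrow>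
      a \<odot>\<^bsub>M\<^esub> (x \<oplus>\<^bsub>M\<^esub> y) = a \<odot>\<^bsub>M\<^esub> x \<oplus>\<^bsub>M\<^esub> a \<odot>\<^bsub>M\<^esub> y"
    and "\<And>a b x. a \<in> carrier R \<Longrightarrow> b \<in> carrier R \<Longrightarrow> x \<in> carrier M \<Longrightarrow>
      (a \<otimes>\<^bsub>R\<^esub> b) \<odot>\<^bsub>M\<^esub> x = a \<odot>\<^bsub>M\<^esub> (b \<odot>\<^bsub>M\<^esub> x)"
    and "\<And>x. x \<in> carrier M \<Longrightarrow> \<one>\<^bsub>R\<^esub> \<odot>\<^bsub>M\<^esub> x = x"
  shows "left_module R M"
  using assms by (simp add: left_module_def left_module_axioms_def)

context left_module
begin

lemma smult_l_null [simp]: "x \<in> carrier M \<Longrightarrow> \<zero> \<odot>\<^bsub>M\<^esub> x = \<zero>\<^bsub>M\<^esub>"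
proof -
  assume x: "x \<in> carrier M"
  have "\<zero> \<odot>\<^bsub>M\<^esub> x \<oplus>\<^bsub>M\<^esub> \<zero> \<odot>\<^bsub>M\<^esub> x = \<zero> \<odot>\<^bsub>M\<^esub> x"
    using smult_l_distr[of \<zero> \<zero> x] x by simp
  then show ?thesis using x by (metis M.add.r_cancel_one' R.zero_closed smult_closed)
qed

lemma smult_r_null [simp]: "a \<in> carrier R \<Longrightarrow> a \<odot>\<^bsub>M\<^esub> \<zero>\<^bsub>M\<^esub> = \<zero>\<^bsub>M\<^esub>"
proof -
  assume a: "a \<in> carrier R"
  have "a \<odot>\<^bsub>M\<^esub> \<zero>\<^bsub>M\<^esub> \<oplus>\<^bsub>M\<^esub> a \<odot>\<^bsub>M\<^esub> \<zero>\<^bsub>M\<^esub> = a \<odot>\<^bsub>M\<^esub> \<zero>\<^bsub>M\<^esub>"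
    using smult_r_distr[of a "\<zero>\<^bsub>M\<^esub>" "\<zero>\<^bsub>M\<^esub>"] a by simp
  then show ?thesis using a by (metis M.add.r_cancel_one' M.zero_closed smult_closed)
qed

lemma a_inv_eq_smult: "x \<in> carrier M \<Longrightarrow> \<ominus>\<^bsub>M\<^esub> x = (\<ominus> \<one>) \<odot>\<^bsub>M\<^esub> x"
proof -
  assume x: "x \<in> carrier M"
  have "(\<ominus> \<one>) \<odot>\<^bsub>M\<^esub> x \<oplus>\<^bsub>M\<^esub> x = \<zero>\<^bsub>M\<^esub>"
    using smult_l_distr[of "\<ominus> \<one>" \<one> x] x by (simp add: R.l_neg)
  then show ?thesis using x by (metis M.minus_equality R.a_inv_closed R.one_closed smult_closed)
qed

lemma submoduleI:
  assumes "H \<subseteq> carrier M" "\<zero>\<^bsub>M\<^esub> \<in> H" "\<And>a b. a \<in> H \<Longrightarrow> b \<in> H \<Longrightarrow> a \<oplus>\<^bsub>M\<^esub> b \<in> H"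
    "\<And>a x. a \<in> carrier R \<Longrightarrow> x \<in> H \<Longrightarrow> a \<odot>\<^bsub>M\<^esub> x \<in> H"
  shows "submodule H R M"
proof (intro submodule.intro subgroup.intro submodule_axioms.intro)
  fix x assume x: "x \<in> H"
  then have "\<ominus>\<^bsub>M\<^esub> x \<in> H" using assms a_inv_eq_smult[of x] by auto
  then show "inv\<^bsub>add_monoid M\<^esub> x \<in> H" by (simp add: a_inv_def)
qed (use assms in auto)

lemma submoduleD:
  assumes "submodule H R M"
  shows "H \<subseteq> carrier M" "\<zero>\<^bsub>M\<^esub> \<in> H" "\<And>a b. a \<in> H \<Longrightarrow> b \<in> H \<Longrightarrow> a \<oplus>\<^bsub>M\<^esub> b \<in> H"
    "\<And>a x. a \<in> carrier R \<Longrightarrow> x \<in> H \<Longrightarrow> a \<odot>\<^bsub>M\<^esub> x \<in> H"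
    "\<And>a. a \<in> H \<Longrightarrow> \<ominus>\<^bsub>M\<^esub> a \<in> H"
proof -
  interpret submodule H R M by fact
  show "H \<subseteq> carrier M" "\<zero>\<^bsub>M\<^esub> \<in> H" "\<And>a b. a \<in> H \<Longrightarrow> b \<in> H \<Longrightarrow> a \<oplus>\<^bsub>M\<^esub> b \<in> H"
    "\<And>a x. a \<in> carrier R \<Longrightarrow> x \<in> H \<Longrightarrow> a \<odot>\<^bsub>M\<^esub> x \<in> H"
    "\<And>a. a \<in> H \<Longrightarrow> \<ominus>\<^bsub>M\<^esub> a \<in> H"
    using subset one_closed m_closed smult_closed m_inv_closed by (auto simp: a_inv_def)
qed

lemma left_module_submod:
  assumes H: "submodule H R M"
  shows "left_module R (submod M H)"
proof (rule left_moduleI)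
  note D = submoduleD[OF H]
  show "abelian_group (submod M H)"
  proof (rule abelian_groupI)
    show "\<exists>y\<in>carrier (submod M H). y \<oplus>\<^bsub>submod M H\<^esub> x = \<zero>\<^bsub>submod M H\<^esub>"
      if "x \<in> carrier (submod M H)" for x
      using that D(1,5) by (intro bexI[of _ "\<ominus>\<^bsub>M\<^esub> x"]) (auto simp: M.l_neg subset_iff)
  qed (use D(1-3) in \<open>simp_all add: M.a_ac subset_iff\<close>)
qed (use submoduleD(1,4)[OF H] in \<open>simp_all add: R.ring_axioms smult_l_distr smult_r_distr smult_assoc1 subset_iff\<close>)

lemma submodule_mod_span:
  assumes "S \<subseteq> carrier M"
  shows "submodule (mod_span R M S) R M" "S \<subseteq> mod_span R M S"
proof -
  have c: "submodule (carrier M) R M" by (rule submoduleI) auto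
  show "submodule (mod_span R M S) R M"
  proof (rule submoduleI)
    show "mod_span R M S \<subseteq> carrier M" using c assms by (auto simp: mod_span_def)
    show "\<zero>\<^bsub>M\<^esub> \<in> mod_span R M S" using submoduleD(2) by (simp add: mod_span_def)
    show "a \<oplus>\<^bsub>M\<^esub> b \<in> mod_span R M S" if "a \<in> mod_span R M S" "b \<in> mod_span R M S" for a b
      using that submoduleD(3) by (simp add: mod_span_def)
    show "a \<odot>\<^bsub>M\<^esub> x \<in> mod_span R M S" if "a \<in> carrier R" "x \<in> mod_span R M S" for a x
      using that submoduleD(4) by (simp add: mod_span_def)
  qed
  show "S \<subseteq> mod_span R M S" by (auto simp: mod_span_def)
qed

lemma mod_span_least: "submodule H R M \<Longrightarrow> S \<subseteq> H \<Longrightarrow> mod_span R M S \<subseteq> H"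
  by (auto simp: mod_span_def)

lemma singular_part_eqI:
  assumes "submodule S R M" "M_singular R N (submod M S)"
    and "\<And>K. submodule K R M \<Longrightarrow> M_singular R N (submod M K) \<Longrightarrow> K \<subseteq> S"
  shows "singular_part R N M = S"
  unfolding singular_part_def submod_sum_def mod_span_def using assms by blast

lemma span_gen:
  fixes l :: "'x \<Rightarrow> _"
  assumes l: "l ` X \<subseteq> carrier M"
  shows "\<exists>g :: _ \<Rightarrow> ('r, 'x) gen. inj_on g (mod_span R M (l ` X))"
proof -
  define v where "v = (\<lambda>xs :: ('r, 'x) gen. foldr (\<lambda>(r, x) s. (r \<odot>\<^bsub>M\<^esub> l x) \<oplus>\<^bsub>M\<^esub> s) xs \<zero>\<^bsub>M\<^esub>)"
  have v0: "v [] = \<zero>\<^bsub>M\<^esub>" and vC: "\<And>r x xs. v ((r, x) # xs) = (r \<odot>\<^bsub>M\<^esub> l x) \<oplus>\<^bsub>M\<^esub> v xs"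
    by (simp_all add: v_def)
  let ?G = "lists (carrier R \<times> X)"
  have vc: "v xs \<in> carrier M" if "xs \<in> ?G" for xs
    using that by induction (use l in \<open>auto simp: v0 vC\<close>)
  have va: "v xs \<oplus>\<^bsub>M\<^esub> v ys = v (xs @ ys)" if "xs \<in> ?G" "ys \<in> ?G" for xs ys
    using that
  proof induction
    case (Cons a xs)
    then show ?case using l vc by (cases a) (auto simp: v0 vC M.a_assoc image_subset_iff)
  qed (simp add: v0 vc)
  have vs: "\<exists>ys\<in>?G. a \<odot>\<^bsub>M\<^esub> v xs = v ys" if "xs \<in> ?G" "a \<in> carrier R" for xs a
    using that
  proof induction
    case Nil
    then show ?case by (auto intro!: bexI[of _ "[]"] simp: v0)
  next
    case (Cons c xs)
    obtain r x where c: "c = (r, x)" by force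
    from Cons obtain ys where "ys \<in> ?G" "a \<odot>\<^bsub>M\<^esub> v xs = v ys" by blast
    then show ?case using Cons c l vc
      by (intro bexI[of _ "(a \<otimes> r, x) # ys"])
        (auto simp: vC smult_r_distr smult_assoc1 image_subset_iff)
  qed
  have "submodule (v ` ?G) R M"
  proof (rule submoduleI)
    show "v ` ?G \<subseteq> carrier M" using vc by blast
    show "\<zero>\<^bsub>M\<^esub> \<in> v ` ?G" by (metis image_eqI lists.Nil v0)
    show "\<And>a b. a \<in> v ` ?G \<Longrightarrow> b \<in> v ` ?G \<Longrightarrow> a \<oplus>\<^bsub>M\<^esub> b \<in> v ` ?G"
      using va by (smt (verit) append_in_lists_conv image_iff)
    show "\<And>a x. a \<in> carrier R \<Longrightarrow> x \<in> v ` ?G \<Longrightarrow> a \<odot>\<^bsub>M\<^esub> x \<in> v ` ?G"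
      using vs by blast
  qed
  moreover have "l ` X \<subseteq> v ` ?G"
  proof
    fix y assume "y \<in> l ` X"
    then obtain x where "x \<in> X" "y = l x" by blast
    then show "y \<in> v ` ?G" using l
      by (intro image_eqI[of _ _ "[(\<one>, x)]"]) (auto simp: v0 vC)
  qed
  ultimately have "mod_span R M (l ` X) \<subseteq> v ` ?G" by (rule mod_span_least)
  then show ?thesis by (meson inj_on_inv_into)
qed

lemma direct_power_memI:
  assumes "\<And>i. i \<in> I \<Longrightarrow> h i \<in> carrier M" "finite F" "\<And>i. i \<in> I \<Longrightarrow> i \<notin> F \<Longrightarrow> h i = \<zero>\<^bsub>M\<^esub>"
  shows "(\<lambda>i\<in>I. h i) \<in> carrier (direct_power I M)"
proof -
  have "{i \<in> I. (\<lambda>i\<in>I. h i) i \<noteq> \<zero>\<^bsub>M\<^esub>} \<subseteq> F" using assms(3) by auto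
  then have "finite {i \<in> I. (\<lambda>i\<in>I. h i) i \<noteq> \<zero>\<^bsub>M\<^esub>}" using assms(2) finite_subset by blast
  then show ?thesis using assms(1) by (simp add: direct_power_def)
qed

lemma direct_power_memD:
  assumes "x \<in> carrier (direct_power I M)"
  shows "\<And>i. i \<in> I \<Longrightarrow> x i \<in> carrier M" "finite {i \<in> I. x i \<noteq> \<zero>\<^bsub>M\<^esub>}" "(\<lambda>i\<in>I. x i) = x"
  using assms by (auto simp: direct_power_def)

lemma left_module_direct_power: "left_module R (direct_power I M)"
proof (rule left_moduleI)
  let ?P = "direct_power I M"
  note D = direct_power_memD
  have add: "x \<oplus>\<^bsub>?P\<^esub> y = (\<lambda>i\<in>I. x i \<oplus>\<^bsub>M\<^esub> y i)" and smult: "r \<odot>\<^bsub>?P\<^esub> x = (\<lambda>i\<in>I. r \<odot>\<^bsub>M\<^esub> x i)"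
    and zero: "\<zero>\<^bsub>?P\<^esub> = (\<lambda>i\<in>I. \<zero>\<^bsub>M\<^esub>)" for x y r
    by (simp_all add: direct_power_def)
  have ext: "(\<lambda>i\<in>I. h i) = x" if "x \<in> carrier ?P" "\<And>i. i \<in> I \<Longrightarrow> h i = x i" for h x
    using D(3)[OF that(1)] that(2) by (metis (mono_tags, lifting) restrict_ext)
  show "abelian_group ?P"
  proof (rule abelian_groupI)
    show "\<zero>\<^bsub>?P\<^esub> \<in> carrier ?P"
      unfolding zero by (rule direct_power_memI[of _ _ "{}"]) auto
  next
    fix x y assume x: "x \<in> carrier ?P" and y: "y \<in> carrier ?P"
    note Dx = D[OF x] and Dy = D[OF y]
    show "x \<oplus>\<^bsub>?P\<^esub> y \<in> carrier ?P"
      unfolding add using Dx(1) Dy(1)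
      by (intro direct_power_memI[OF _ finite_UnI[OF Dx(2) Dy(2)]]) auto
    show "x \<oplus>\<^bsub>?P\<^esub> y = y \<oplus>\<^bsub>?P\<^esub> x"
      unfolding add using Dx(1) Dy(1) by (auto intro!: restrict_ext M.a_comm)
  next
    fix x y z assume x: "x \<in> carrier ?P" and y: "y \<in> carrier ?P" and z: "z \<in> carrier ?P"
    show "x \<oplus>\<^bsub>?P\<^esub> y \<oplus>\<^bsub>?P\<^esub> z = x \<oplus>\<^bsub>?P\<^esub> (y \<oplus>\<^bsub>?P\<^esub> z)"
      unfolding add using D(1)[OF x] D(1)[OF y] D(1)[OF z]
      by (auto intro!: restrict_ext M.a_assoc)
  next
    fix x assume x: "x \<in> carrier ?P"
    note Dx = D[OF x]
    show "\<zero>\<^bsub>?P\<^esub> \<oplus>\<^bsub>?P\<^esub> x = x"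
      unfolding add zero using Dx(1) by (intro ext[OF x]) auto
    have "(\<lambda>i\<in>I. \<ominus>\<^bsub>M\<^esub> x i) \<in> carrier ?P"
      using Dx(1) by (intro direct_power_memI[OF _ Dx(2)]) auto
    moreover have "(\<lambda>i\<in>I. \<ominus>\<^bsub>M\<^esub> x i) \<oplus>\<^bsub>?P\<^esub> x = \<zero>\<^bsub>?P\<^esub>"
      unfolding add zero using Dx(1) by (auto intro!: restrict_ext simp: M.l_neg)
    ultimately show "\<exists>y\<in>carrier ?P. y \<oplus>\<^bsub>?P\<^esub> x = \<zero>\<^bsub>?P\<^esub>" by blast
  qed
  fix a b x y assume a: "a \<in> carrier R" and x: "x \<in> carrier ?P"
  note Dx = D[OF x]
  show "a \<odot>\<^bsub>?P\<^esub> x \<in> carrier ?P"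
    unfolding smult using Dx(1) a by (intro direct_power_memI[OF _ Dx(2)]) auto
  show "a \<odot>\<^bsub>?P\<^esub> (x \<oplus>\<^bsub>?P\<^esub> y) = a \<odot>\<^bsub>?P\<^esub> x \<oplus>\<^bsub>?P\<^esub> a \<odot>\<^bsub>?P\<^esub> y" if "y \<in> carrier ?P"
    unfolding smult add using Dx(1) D(1)[OF that] a
    by (auto intro!: restrict_ext simp: smult_r_distr)
  assume b: "b \<in> carrier R"
  show "(a \<oplus> b) \<odot>\<^bsub>?P\<^esub> x = a \<odot>\<^bsub>?P\<^esub> x \<oplus>\<^bsub>?P\<^esub> b \<odot>\<^bsub>?P\<^esub> x"
    unfolding smult add using Dx(1) a b by (auto intro!: restrict_ext simp: smult_l_distr)
  show "(a \<otimes> b) \<odot>\<^bsub>?P\<^esub> x = a \<odot>\<^bsub>?P\<^esub> (b \<odot>\<^bsub>?P\<^esub> x)"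
    unfolding smult using Dx(1) a b by (auto intro!: restrict_ext simp: smult_assoc1)
next
  fix x assume x: "x \<in> carrier (direct_power I M)"
  show "\<one> \<odot>\<^bsub>direct_power I M\<^esub> x = x"
    using direct_power_memD[OF x]
    by (auto simp: direct_power_def fun_eq_iff restrict_def split: if_splits)
qed (rule R.ring_axioms)

end

lemma mod_homI:
  assumes "\<And>x. x \<in> carrier M \<Longrightarrow> f x \<in> carrier N" "f \<in> extensional (carrier M)"
    "\<And>x y. x \<in> carrier M \<Longrightarrow> y \<in> carrier M \<Longrightarrow> f (x \<oplus>\<^bsub>M\<^esub> y) = f x \<oplus>\<^bsub>N\<^esub> f y"
    "\<And>r x. r \<in> carrier R \<Longrightarrow> x \<in> carrier M \<Longrightarrow> f (r \<odot>\<^bsub>M\<^esub> x) = r \<odot>\<^bsub>N\<^esub> f x"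
  shows "f \<in> mod_hom R M N"
  using assms by (auto simp: mod_hom_def PiE_iff)

lemma mod_homD:
  assumes "f \<in> mod_hom R M N"
  shows "\<And>x. x \<in> carrier M \<Longrightarrow> f x \<in> carrier N" "f \<in> extensional (carrier M)"
    "\<And>x y. x \<in> carrier M \<Longrightarrow> y \<in> carrier M \<Longrightarrow> f (x \<oplus>\<^bsub>M\<^esub> y) = f x \<oplus>\<^bsub>N\<^esub> f y"
    "\<And>r x. r \<in> carrier R \<Longrightarrow> x \<in> carrier M \<Longrightarrow> f (r \<odot>\<^bsub>M\<^esub> x) = r \<odot>\<^bsub>N\<^esub> f x"
  using assms by (auto simp: mod_hom_def PiE_iff)

lemma mod_hom_zero:
  assumes "left_module R M" "left_module R N" "f \<in> mod_hom R M N"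
  shows "f \<zero>\<^bsub>M\<^esub> = \<zero>\<^bsub>N\<^esub>"
proof -
  interpret M: left_module R M by fact
  interpret N: left_module R N by fact
  have "f \<zero>\<^bsub>M\<^esub> \<oplus>\<^bsub>N\<^esub> f \<zero>\<^bsub>M\<^esub> = f \<zero>\<^bsub>M\<^esub>"
    using mod_homD(3)[OF assms(3), of "\<zero>\<^bsub>M\<^esub>" "\<zero>\<^bsub>M\<^esub>"] by simp
  then show ?thesis using mod_homD(1)[OF assms(3), of "\<zero>\<^bsub>M\<^esub>"] by simp
qed

lemma mod_hom_compose:
  assumes "left_module R M" "f \<in> mod_hom R M N" "g \<in> mod_hom R N P"
  shows "compose (carrier M) g f \<in> mod_hom R M P"
proof -
  interpret M: left_module R M by fact
  show ?thesis
    using mod_homD[OF assms(2)] mod_homD[OF assms(3)]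
    by (intro mod_homI) (auto simp: compose_def)
qed

lemma mod_hom_restrict:
  assumes "left_module R M" "f \<in> mod_hom R M N" "submodule H R M" "f ` H \<subseteq> carrier P"
    "add P = add N" "smult P = smult N"
  shows "restrict f H \<in> mod_hom R (submod M H) P"
proof -
  interpret M: left_module R M by fact
  show ?thesis
    using mod_homD[OF assms(2)] M.submoduleD[OF assms(3)] assms
    by (intro mod_homI) (auto simp: subset_iff)
qed

lemma submodule_image:
  assumes M: "left_module R M" and N: "left_module R N" and f: "f \<in> mod_hom R M N"
    and H: "submodule H R M"
  shows "submodule (f ` H) R N"
proof -
  interpret M: left_module R M by fact
  interpret N: left_module R N by fact
  note D = M.submoduleD[OF H] and F = mod_homD[OF f]
  show ?thesis
  proof (rule N.submoduleI)
    show "f ` H \<subseteq> carrier N" using D F by auto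
    show "\<zero>\<^bsub>N\<^esub> \<in> f ` H" using D mod_hom_zero[OF M N f] by (metis image_eqI)
    show "a \<oplus>\<^bsub>N\<^esub> b \<in> f ` H" if "a \<in> f ` H" "b \<in> f ` H" for a b
      using that D F by (smt (verit) image_iff subset_iff)
    show "a \<odot>\<^bsub>N\<^esub> b \<in> f ` H" if "a \<in> carrier R" "b \<in> f ` H" for a b
      using that D F by (smt (verit) image_iff subset_iff)
  qed
qed

lemma submodule_carrier: "left_module R M \<Longrightarrow> submodule (carrier M) R M"
proof -
  assume "left_module R M"
  then interpret left_module R M .
  show ?thesis by (rule submoduleI) auto
qed

lemma submodule_ker:
  assumes M: "left_module R M" and N: "left_module R N" and f: "f \<in> mod_hom R M N"
  shows "submodule (mod_ker M N f) R M"
proof -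
  interpret M: left_module R M by fact
  interpret N: left_module R N by fact
  show ?thesis
    using mod_homD[OF f] mod_hom_zero[OF M N f]
    by (intro M.submoduleI) (auto simp: mod_ker_def)
qed

lemma transport:
  fixes L :: "('r, 'l) module" and g :: "'l \<Rightarrow> 'u"
  assumes L: "left_module R L" and g: "inj_on g (carrier L)"
  obtains L' :: "('r, 'u) module" where "left_module R L'" "carrier L' = g ` carrier L"
    "restrict g (carrier L) \<in> mod_hom R L L'"
    "restrict (inv_into (carrier L) g) (carrier L') \<in> mod_hom R L' L"
proof -
  interpret L: left_module R L by fact
  let ?h = "inv_into (carrier L) g"
  define L' :: "('r, 'u) module" where "L' = \<lparr>carrier = g ` carrier L, mult = undefined, one = undefined,
    zero = g \<zero>\<^bsub>L\<^esub>, add = (\<lambda>x y. g (?h x \<oplus>\<^bsub>L\<^esub> ?h y)), smult = (\<lambda>r x. g (r \<odot>\<^bsub>L\<^esub> ?h x))\<rparr>"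
  have h [simp]: "?h (g x) = x" if "x \<in> carrier L" for x
    using that g by simp
  have c: "carrier L' = g ` carrier L" and z: "\<zero>\<^bsub>L'\<^esub> = g \<zero>\<^bsub>L\<^esub>"
    by (simp_all add: L'_def)
  have add: "g x \<oplus>\<^bsub>L'\<^esub> g y = g (x \<oplus>\<^bsub>L\<^esub> y)" if "x \<in> carrier L" "y \<in> carrier L" for x y
    using that by (simp add: L'_def)
  have sm: "r \<odot>\<^bsub>L'\<^esub> g x = g (r \<odot>\<^bsub>L\<^esub> x)" if "x \<in> carrier L" for r x
    using that by (simp add: L'_def)
  note s = c z add sm
  have "abelian_group L'"
  proof (rule abelian_groupI)
    fix x assume "x \<in> carrier L'"
    then obtain y where "y \<in> carrier L" "x = g y" by (auto simp: c)
    then show "\<exists>y\<in>carrier L'. y \<oplus>\<^bsub>L'\<^esub> x = \<zero>\<^bsub>L'\<^esub>"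
      by (intro bexI[of _ "g (\<ominus>\<^bsub>L\<^esub> y)"]) (simp_all add: s L.M.l_neg)
  next
    fix x y assume "x \<in> carrier L'" "y \<in> carrier L'"
    then show "x \<oplus>\<^bsub>L'\<^esub> y = y \<oplus>\<^bsub>L'\<^esub> x" by (auto simp: s L.M.a_comm)
  qed (auto simp: s L.M.a_assoc)
  then have "left_module R L'"
    by (rule left_moduleI[OF L.R.ring_axioms])
      (auto simp: s L.smult_l_distr L.smult_r_distr L.smult_assoc1)
  moreover have "restrict g (carrier L) \<in> mod_hom R L L'"
    by (rule mod_homI) (auto simp: s)
  moreover have "restrict ?h (carrier L') \<in> mod_hom R L' L"
    by (rule mod_homI) (auto simp: s dest!: inj_onD[OF g])
  ultimately show ?thesis by (intro that[of L']) (auto simp: c)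
qed

lemma mod_hom_submod:
  assumes "f \<in> mod_hom R M N" "f ` carrier M \<subseteq> H"
  shows "f \<in> mod_hom R M (submod N H)"
  using mod_homD[OF assms(1)] assms(2) by (intro mod_homI) auto

lemma mod_hom_submodD:
  assumes "f \<in> mod_hom R M (submod N H)" "H \<subseteq> carrier N"
  shows "f \<in> mod_hom R M N"
  using mod_homD[OF assms(1)] assms(2) by (intro mod_homI) auto

lemma mod_hom_incl:
  assumes "left_module R M" "submodule H R M"
  shows "(\<lambda>x\<in>H. x) \<in> mod_hom R (submod M H) M"
proof -
  interpret left_module R M by fact
  show ?thesis using submoduleD[OF assms(2)] by (intro mod_homI) auto
qed

lemma mod_hom_lift:
  assumes M: "left_module R M" and P: "left_module R P" and f: "f \<in> mod_hom R M N"
    and h: "h \<in> mod_hom R P N" "inj_on h (carrier P)" and sub: "f ` carrier M \<subseteq> h ` carrier P"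
  shows "\<exists>g \<in> mod_hom R M P. \<forall>m\<in>carrier M. h (g m) = f m"
proof -
  interpret M: left_module R M by fact
  interpret P: left_module R P by fact
  define g where "g = (\<lambda>m\<in>carrier M. inv_into (carrier P) h (f m))"
  have gc: "g m \<in> carrier P" and hg: "h (g m) = f m" if "m \<in> carrier M" for m
    using that sub by (auto simp: g_def f_inv_into_f inv_into_into image_subset_iff)
  have eq: "x = y" if "x \<in> carrier P" "y \<in> carrier P" "h x = h y" for x y
    using that h(2) by (simp add: inj_on_eq_iff)
  have "g \<in> mod_hom R M P"
  proof (rule mod_homI)
    show "g (x \<oplus>\<^bsub>M\<^esub> y) = g x \<oplus>\<^bsub>P\<^esub> g y" if "x \<in> carrier M" "y \<in> carrier M" for x y
      using that by (intro eq) (simp_all add: gc hg mod_homD(3)[OF f] mod_homD(3)[OF h(1)])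
    show "g (r \<odot>\<^bsub>M\<^esub> x) = r \<odot>\<^bsub>P\<^esub> g x" if "r \<in> carrier R" "x \<in> carrier M" for r x
      using that by (intro eq) (simp_all add: gc hg mod_homD(4)[OF f] mod_homD(4)[OF h(1)])
  qed (use gc in \<open>auto simp: g_def\<close>)
  then show ?thesis using hg by blast
qed

lemma transport_submod:
  fixes L :: "('r, 'l) module" and g :: "'l \<Rightarrow> 'u"
  assumes L: "left_module R L" and H: "submodule H R L" and g: "inj_on g H"
  obtains L' :: "('r, 'u) module" where "left_module R L'" "carrier L' = g ` H"
    "restrict g H \<in> mod_hom R (submod L H) L'"
    "restrict (inv_into H g) (carrier L') \<in> mod_hom R L' L"
proof -
  interpret L: left_module R L by fact
  have g': "inj_on g (carrier (submod L H))" using g by simp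
  show ?thesis
  proof (rule transport[OF L.left_module_submod[OF H] g'])
    fix L' :: "('r, 'u) module"
    assume *: "left_module R L'" "carrier L' = g ` carrier (submod L H)"
      "restrict g (carrier (submod L H)) \<in> mod_hom R (submod L H) L'"
      "restrict (inv_into (carrier (submod L H)) g) (carrier L') \<in> mod_hom R L' (submod L H)"
    show thesis
      by (rule that[OF *(1)])
        (use * mod_hom_submodD[OF *(4) L.submoduleD(1)[OF H]] in simp_all)
  qed
qed

lemma in_sigmaI:
  fixes M :: "('r, 'm) module" and N :: "('r, 'n) module" and I :: "('n \<times> nat) set"
    and Q :: "('r, ('n \<times> nat \<Rightarrow> 'm) set) module"
  assumes "left_module R N" "left_module R Q" "p \<in> mod_hom R (direct_power I M) Q"
    "p ` carrier (direct_power I M) = carrier Q" "j \<in> mod_hom R N Q" "inj_on j (carrier N)"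
  shows "in_sigma R M N"
  unfolding in_sigma_def
  by (rule conjI[OF assms(1)], rule exI[of _ I], rule exI[of _ Q], rule exI[of _ p],
    rule exI[of _ j]) (simp add: assms)

lemma in_sigmaE:
  fixes M :: "('r, 'm) module" and N :: "('r, 'n) module"
  assumes "in_sigma R M N"
  obtains I :: "('n \<times> nat) set" and Q :: "('r, ('n \<times> nat \<Rightarrow> 'm) set) module" and p j
  where "left_module R Q" "p \<in> mod_hom R (direct_power I M) Q"
    "p ` carrier (direct_power I M) = carrier Q" "j \<in> mod_hom R N Q" "inj_on j (carrier N)"
  using assms unfolding in_sigma_def by (elim conjE exE) (rule that)

theorem in_sigma_any:
  fixes I' :: "'i set" and Q' :: "('r, 'q) module" and N :: "('r, 'n) module"
    and M :: "('r, 'm) module"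
  assumes M: "left_module R M" and N: "left_module R N" and Q': "left_module R Q'"
    and p: "p \<in> mod_hom R (direct_power I' M) Q'"
    and onto: "p ` carrier (direct_power I' M) = carrier Q'"
    and j: "j \<in> mod_hom R N Q'" "inj_on j (carrier N)"
  shows "in_sigma R M N"
proof -
  interpret M: left_module R M by fact
  interpret Q': left_module R Q' by fact
  let ?P' = "direct_power I' M"
  have "\<exists>x. x \<in> carrier ?P' \<and> p x = j n" if "n \<in> carrier N" for n
    using that onto mod_homD(1)[OF j(1)] by (metis imageE)
  then obtain w where w: "\<And>n. n \<in> carrier N \<Longrightarrow> w n \<in> carrier ?P'"
    "\<And>n. n \<in> carrier N \<Longrightarrow> p (w n) = j n" by metis
  define supp where "supp n = {i \<in> I'. w n i \<noteq> \<zero>\<^bsub>M\<^esub>}" for n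
  have fin: "finite (supp n)" if "n \<in> carrier N" for n
    using M.direct_power_memD(2)[OF w(1)[OF that]] by (simp add: supp_def)
  have "\<exists>e :: 'i \<Rightarrow> nat. inj_on e (supp n)" if "n \<in> carrier N" for n
    using finite_imp_inj_to_nat_seg[OF fin[OF that]] by blast
  then obtain en :: "'n \<Rightarrow> 'i \<Rightarrow> nat" where en: "\<And>n. n \<in> carrier N \<Longrightarrow> inj_on (en n) (supp n)"
    by metis
  define S where "S = (\<Union>n\<in>carrier N. supp n)"
  have SI: "S \<subseteq> I'" by (auto simp: S_def supp_def)
  have "\<exists>n. n \<in> carrier N \<and> s \<in> supp n" if "s \<in> S" for s
    using that by (auto simp: S_def)
  then obtain c :: "'i \<Rightarrow> 'n" where c: "\<And>s. s \<in> S \<Longrightarrow> c s \<in> carrier N" "\<And>s. s \<in> S \<Longrightarrow> s \<in> supp (c s)"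
    by metis
  define h where "h s = (c s, en (c s) s)" for s
  have h: "inj_on h S"
  proof (rule inj_onI)
    fix s t assume "s \<in> S" "t \<in> S" "h s = h t"
    then have "c s = c t" "en (c s) s = en (c s) t" by (auto simp: h_def)
    then show "s = t"
      using inj_onD[OF en[OF c(1)[OF \<open>s \<in> S\<close>]]] c(2)[OF \<open>s \<in> S\<close>] c(2)[OF \<open>t \<in> S\<close>] by metis
  qed
  define I where "I = h ` S"
  let ?P = "direct_power I M"
  have P: "left_module R ?P" and P': "left_module R ?P'"
    by (rule M.left_module_direct_power)+
  define T where "T = (\<lambda>f\<in>carrier ?P. \<lambda>i\<in>I'. if i \<in> S then f (h i) else \<zero>\<^bsub>M\<^esub>)"
  have T: "T \<in> mod_hom R ?P ?P'"
  proof (rule mod_homI)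
    fix x assume x: "x \<in> carrier ?P"
    note D = M.direct_power_memD[OF x]
    have "finite (h -` {i \<in> I. x i \<noteq> \<zero>\<^bsub>M\<^esub>} \<inter> S)"
      by (rule finite_vimage_IntI[OF D(2) h])
    then have "(\<lambda>i\<in>I'. if i \<in> S then x (h i) else \<zero>\<^bsub>M\<^esub>) \<in> carrier ?P'"
      by (rule M.direct_power_memI[rotated]) (use D(1) in \<open>auto simp: I_def\<close>)
    then show "T x \<in> carrier ?P'" using x by (simp add: T_def)
  next
    fix x y assume x: "x \<in> carrier ?P" and y: "y \<in> carrier ?P"
    interpret P: left_module R ?P by (rule P)
    have "x \<oplus>\<^bsub>?P\<^esub> y \<in> carrier ?P" using x y by simp
    then show "T (x \<oplus>\<^bsub>?P\<^esub> y) = T x \<oplus>\<^bsub>?P'\<^esub> T y"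
      using x y by (simp add: T_def) (auto simp: direct_power_def I_def fun_eq_iff)
  next
    fix r x assume r: "r \<in> carrier R" and x: "x \<in> carrier ?P"
    interpret P: left_module R ?P by (rule P)
    have "r \<odot>\<^bsub>?P\<^esub> x \<in> carrier ?P" using x r by simp
    then show "T (r \<odot>\<^bsub>?P\<^esub> x) = r \<odot>\<^bsub>?P'\<^esub> T x"
      using x r by (simp add: T_def) (auto simp: direct_power_def I_def fun_eq_iff)
  qed (simp add: T_def)
  define f where "f = compose (carrier ?P) p T"
  have f: "f \<in> mod_hom R ?P Q'"
    unfolding f_def by (rule mod_hom_compose[OF P T p])
  define H where "H = f ` carrier ?P"
  have H: "submodule H R Q'"
    unfolding H_def by (rule submodule_image[OF P Q' f submodule_carrier[OF P]])
  have jH: "j n \<in> H" if n: "n \<in> carrier N" for n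
  proof -
    note D = M.direct_power_memD[OF w(1)[OF n]]
    have sn: "supp n \<subseteq> S" using n by (auto simp: S_def)
    define x where "x = (\<lambda>t\<in>I. w n (inv_into S h t))"
    have inv: "inv_into S h t \<in> S" if "t \<in> I" for t
      using that by (auto simp: I_def inv_into_into)
    have x: "x \<in> carrier ?P"
      unfolding x_def
    proof (rule M.direct_power_memI)
      show "finite (h ` supp n)" using fin[OF n] by blast
      show "w n (inv_into S h t) \<in> carrier M" if "t \<in> I" for t
        using inv[OF that] SI D(1) by blast
      show "w n (inv_into S h t) = \<zero>\<^bsub>M\<^esub>" if "t \<in> I" "t \<notin> h ` supp n" for t
        using that inv[OF that(1)] SI f_inv_into_f[of t h S]
        by (auto simp: supp_def I_def image_iff)
    qed
    have "T x = (\<lambda>i\<in>I'. w n i)"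
      using x h sn by (auto simp: T_def x_def I_def supp_def fun_eq_iff)
    then have "f x = j n" using x w(2)[OF n] D(3) by (simp add: f_def compose_def)
    then show ?thesis unfolding H_def using x by (intro image_eqI[of _ _ x]) simp_all
  qed
  define g where "g q = {x \<in> carrier ?P. f x = q}" for q
  have g: "inj_on g H"
  proof (rule inj_onI)
    fix q q' assume "q \<in> H" and eq: "g q = g q'"
    then obtain x where "x \<in> carrier ?P" "q = f x" by (auto simp: H_def)
    then have "x \<in> g q'" using eq[symmetric] by (simp add: g_def)
    then show "q = q'" using \<open>q = f x\<close> by (simp add: g_def)
  qed
  obtain Q where Q: "left_module R Q" "carrier Q = g ` H"
    "restrict g H \<in> mod_hom R (submod Q' H) Q"
    by (rule transport_submod[OF Q' H g])
  have f': "f \<in> mod_hom R ?P (submod Q' H)" by (rule mod_hom_submod[OF f]) (simp add: H_def)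
  have j': "j \<in> mod_hom R N (submod Q' H)" by (rule mod_hom_submod[OF j(1)]) (use jH in auto)
  let ?p = "compose (carrier ?P) (restrict g H) f"
  let ?j = "compose (carrier N) (restrict g H) j"
  have "?p \<in> mod_hom R ?P Q" by (rule mod_hom_compose[OF P f' Q(3)])
  moreover have "?p ` carrier ?P = carrier Q"
    using Q(2) by (simp add: compose_def H_def image_image)
  moreover have "?j \<in> mod_hom R N Q" by (rule mod_hom_compose[OF N j' Q(3)])
  moreover have "inj_on ?j (carrier N)"
  proof (rule inj_onI)
    fix x y assume "x \<in> carrier N" "y \<in> carrier N" "?j x = ?j y"
    then have "g (j x) = g (j y)" using jH by (simp add: compose_def)
    then have "j x = j y" using inj_onD[OF g] jH \<open>x \<in> carrier N\<close> \<open>y \<in> carrier N\<close> by simp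
    then show "x = y" using inj_onD[OF j(2)] \<open>x \<in> carrier N\<close> \<open>y \<in> carrier N\<close> by simp
  qed
  ultimately show ?thesis by (intro in_sigmaI[OF N Q(1)])
qed

lemma in_sigma_embed:
  assumes M: "left_module R M" and N: "left_module R N" and N': "in_sigma R M N'"
    and f: "f \<in> mod_hom R N N'" "inj_on f (carrier N)"
  shows "in_sigma R M N"
proof (rule in_sigmaE[OF N'])
  fix I Q p j
  assume *: "left_module R Q" "p \<in> mod_hom R (direct_power I M) Q"
      "p ` carrier (direct_power I M) = carrier Q" "j \<in> mod_hom R N' Q" "inj_on j (carrier N')"
  have "inj_on (compose (carrier N) j f) (carrier N)"
  proof (rule inj_onI)
    fix x y assume x: "x \<in> carrier N" and y: "y \<in> carrier N"
      and eq: "compose (carrier N) j f x = compose (carrier N) j f y"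
    have "j (f x) = j (f y)" using eq x y by (simp add: compose_def)
    then have "f x = f y"
      by (rule inj_onD[OF *(5) _ mod_homD(1)[OF f(1) x] mod_homD(1)[OF f(1) y]])
    then show "x = y" by (rule inj_onD[OF f(2) _ x y])
  qed
  then show ?thesis
    by (rule in_sigma_any[OF M N *(1-3) mod_hom_compose[OF N f(1) *(4)]])
qed

lemma compose_apply: "x \<in> A \<Longrightarrow> compose A g f x = g (f x)"
  by (simp add: compose_def)

lemma hom_exactI:
  assumes M: "left_module R M" and ex: "short_exact R K i L p X"
    and lift: "\<And>f. f \<in> mod_hom R M X \<Longrightarrow>
      \<exists>g\<in>mod_hom R M L. \<forall>m\<in>carrier M. p (g m) = f m"
  shows "hom_exact R M K i L p X"
proof -
  have K: "left_module R K" and L: "left_module R L" and X: "left_module R X"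
    and i: "i \<in> mod_hom R K L" "inj_on i (carrier K)" and p: "p \<in> mod_hom R L X"
    and ker: "i ` carrier K = mod_ker L X p"
    using ex unfolding short_exact_def by blast+
  let ?c = "compose (carrier M)"
  have "inj_on (?c i) (mod_hom R M K)"
  proof (rule inj_onI)
    fix f g assume f: "f \<in> mod_hom R M K" and g: "g \<in> mod_hom R M K" and eq: "?c i f = ?c i g"
    have "f m = g m" if m: "m \<in> carrier M" for m
    proof -
      have "i (f m) = i (g m)" using fun_cong[OF eq, of m] m by (simp add: compose_apply)
      then show ?thesis by (rule inj_onD[OF i(2) _ mod_homD(1)[OF f m] mod_homD(1)[OF g m]])
    qed
    then show "f = g" by (rule extensionalityI[OF mod_homD(2)[OF f] mod_homD(2)[OF g]])
  qed
  moreover have "?c i ` mod_hom R M K = {g \<in> mod_hom R M L. ?c p g = (\<lambda>m\<in>carrier M. \<zero>\<^bsub>X\<^esub>)}"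
  proof (intro equalityI subsetI)
    fix g assume "g \<in> ?c i ` mod_hom R M K"
    then obtain f where f: "f \<in> mod_hom R M K" and g: "g = ?c i f" by blast
    have "p (i (f m)) = \<zero>\<^bsub>X\<^esub>" if "m \<in> carrier M" for m
      using mod_homD(1)[OF f that] ker by (auto simp: mod_ker_def)
    then have "?c p g = (\<lambda>m\<in>carrier M. \<zero>\<^bsub>X\<^esub>)" by (auto simp: g compose_def fun_eq_iff)
    then show "g \<in> {g \<in> mod_hom R M L. ?c p g = (\<lambda>m\<in>carrier M. \<zero>\<^bsub>X\<^esub>)}"
      using mod_hom_compose[OF M f i(1)] g by simp
  next
    fix g assume "g \<in> {g \<in> mod_hom R M L. ?c p g = (\<lambda>m\<in>carrier M. \<zero>\<^bsub>X\<^esub>)}"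
    then have g: "g \<in> mod_hom R M L" and eq: "?c p g = (\<lambda>m\<in>carrier M. \<zero>\<^bsub>X\<^esub>)" by simp_all
    have "g m \<in> i ` carrier K" if m: "m \<in> carrier M" for m
      using fun_cong[OF eq, of m] m mod_homD(1)[OF g m]
      by (simp add: ker mod_ker_def compose_apply)
    then have "g ` carrier M \<subseteq> i ` carrier K" by blast
    then obtain f where f: "f \<in> mod_hom R M K" "\<forall>m\<in>carrier M. i (f m) = g m"
      using mod_hom_lift[OF M K g i] by blast
    have "g = ?c i f"
      by (rule extensionalityI[OF mod_homD(2)[OF g] compose_extensional])
        (simp add: compose_apply f(2))
    then show "g \<in> ?c i ` mod_hom R M K" using f(1) by blast
  qed
  moreover have "?c p ` mod_hom R M L = mod_hom R M X"
  proof (intro equalityI subsetI)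
    fix f assume "f \<in> ?c p ` mod_hom R M L"
    then show "f \<in> mod_hom R M X" using mod_hom_compose[OF M _ p] by blast
  next
    fix f assume f: "f \<in> mod_hom R M X"
    then obtain g where g: "g \<in> mod_hom R M L" "\<forall>m\<in>carrier M. p (g m) = f m"
      using lift by blast
    have "f = ?c p g"
      by (rule extensionalityI[OF mod_homD(2)[OF f] compose_extensional])
        (simp add: compose_apply g(2))
    then show "f \<in> ?c p ` mod_hom R M L" using g(1) by blast
  qed
  ultimately show ?thesis by (simp add: hom_exact_def)
qed

(* Restriction of a short exact sequence to the submodule of L generated by a family indexed
   by elements of 'y, realised on the type ('r, 'y) gen. *)
lemma small_short_exact:
  fixes l :: "'y \<Rightarrow> 'l" and L :: "('r, 'l) module" and X :: "('r, 'x) module"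
  assumes ex: "short_exact R K i L p X" and l: "l ` Y \<subseteq> carrier L"
  obtains K1 :: "('r, ('r, 'y) gen) module" and i1
    and L1 :: "('r, ('r, 'y) gen) module" and p1 and X1 :: "('r, ('r, 'y) gen) module" and hL hX
  where "short_exact R K1 i1 L1 p1 X1"
    "hL \<in> mod_hom R L1 L" "inj_on hL (carrier L1)" "l ` Y \<subseteq> hL ` carrier L1"
    "hX \<in> mod_hom R X1 X" "inj_on hX (carrier X1)"
    "\<And>y. y \<in> carrier L1 \<Longrightarrow> hX (p1 y) = p (hL y)"
proof -
  have L: "left_module R L" and X: "left_module R X" and p: "p \<in> mod_hom R L X"
    using ex unfolding short_exact_def by blast+
  interpret L: left_module R L by fact
  interpret X: left_module R X by fact
  define H where "H = mod_span R L (l ` Y)"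
  have H: "submodule H R L" and lH: "l ` Y \<subseteq> H"
    unfolding H_def by (rule L.submodule_mod_span[OF l])+
  note HL = L.submoduleD(1)[OF H]
  obtain g :: "'l \<Rightarrow> ('r, 'y) gen" where g: "inj_on g H"
    using L.span_gen[OF l] unfolding H_def by (elim exE)
  define H' where "H' = p ` H"
  have H': "submodule H' R X" unfolding H'_def by (rule submodule_image[OF L X p H])
  note HX = X.submoduleD(1)[OF H']
  have invH: "inv_into H p y \<in> H" "p (inv_into H p y) = y" if "y \<in> H'" for y
    using that by (simp_all add: H'_def inv_into_into f_inv_into_f)
  have g': "inj_on (\<lambda>y. g (inv_into H p y)) H'"
  proof (rule inj_onI)
    fix y z assume "y \<in> H'" "z \<in> H'" and eq: "g (inv_into H p y) = g (inv_into H p z)"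
    from eq have "inv_into H p y = inv_into H p z"
      by (rule inj_onD[OF g _ invH(1)[OF \<open>y \<in> H'\<close>] invH(1)[OF \<open>z \<in> H'\<close>]])
    then have "p (inv_into H p y) = p (inv_into H p z)" by (rule arg_cong)
    then show "y = z" unfolding invH(2)[OF \<open>y \<in> H'\<close>] invH(2)[OF \<open>z \<in> H'\<close>] .
  qed
  obtain L1 :: "('r, ('r, 'y) gen) module" where L1: "left_module R L1" "carrier L1 = g ` H"
      "restrict (inv_into H g) (carrier L1) \<in> mod_hom R L1 L"
    by (rule transport_submod[OF L H g])
  obtain X1 :: "('r, ('r, 'y) gen) module" where X1: "left_module R X1"
      "carrier X1 = (\<lambda>y. g (inv_into H p y)) ` H'"
      "restrict (inv_into H' (\<lambda>y. g (inv_into H p y))) (carrier X1) \<in> mod_hom R X1 X"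
    by (rule transport_submod[OF X H' g'])
  define hL where "hL = restrict (inv_into H g) (carrier L1)"
  define hX where "hX = restrict (inv_into H' (\<lambda>y. g (inv_into H p y))) (carrier X1)"
  have hL: "hL \<in> mod_hom R L1 L" unfolding hL_def by (rule L1(3))
  have hX: "hX \<in> mod_hom R X1 X" unfolding hX_def by (rule X1(3))
  have hL_inj: "inj_on hL (carrier L1)"
    using inj_on_inv_into[of "carrier L1" g H] L1(2) by (simp add: hL_def)
  have hX_inj: "inj_on hX (carrier X1)"
    using inj_on_inv_into[of "carrier X1" "\<lambda>y. g (inv_into H p y)" H'] X1(2) by (simp add: hX_def)
  have hL_im: "hL ` carrier L1 = H"
    using g by (simp add: hL_def L1(2) image_image)
  have hX_im: "hX ` carrier X1 = H'"
    unfolding hX_def image_restrict_eq X1(2) by (rule inv_into_image_cancel[OF g' subset_refl])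
  have c: "compose (carrier L1) p hL \<in> mod_hom R L1 X" by (rule mod_hom_compose[OF L1(1) hL p])
  have c_im: "compose (carrier L1) p hL ` carrier L1 = H'"
    using hL_im by (auto simp: H'_def compose_def)
  obtain p1 where p1: "p1 \<in> mod_hom R L1 X1" "\<forall>y\<in>carrier L1. hX (p1 y) = compose (carrier L1) p hL y"
    using mod_hom_lift[OF L1(1) X1(1) c hX hX_inj] c_im hX_im by blast
  have sq: "hX (p1 y) = p (hL y)" if "y \<in> carrier L1" for y
    using p1(2) that by (simp add: compose_apply)
  have onto: "p1 ` carrier L1 = carrier X1"
  proof (intro equalityI subsetI)
    fix x assume x: "x \<in> carrier X1"
    then have "hX x \<in> compose (carrier L1) p hL ` carrier L1" using c_im hX_im by blast
    then obtain y where y: "y \<in> carrier L1" "hX x = compose (carrier L1) p hL y"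
      by (rule imageE)
    have "hX x = hX (p1 y)" using p1(2) y by simp
    then have "x = p1 y" by (rule inj_onD[OF hX_inj _ x mod_homD(1)[OF p1(1) y(1)]])
    then show "x \<in> p1 ` carrier L1" using y by blast
  qed (use mod_homD(1)[OF p1(1)] in blast)
  let ?K = "mod_ker L1 X1 p1"
  have K: "submodule ?K R L1" by (rule submodule_ker[OF L1(1) X1(1) p1(1)])
  interpret L1: left_module R L1 by (rule L1(1))
  have "short_exact R (submod L1 ?K) (\<lambda>x\<in>?K. x) L1 p1 X1"
    unfolding short_exact_def
    by (intro conjI L1.left_module_submod[OF K] L1(1) X1(1) p1(1) onto mod_hom_incl[OF L1(1) K])
      (simp_all add: inj_on_def)
  moreover have "l ` Y \<subseteq> hL ` carrier L1" using lH hL_im by simp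
  ultimately show ?thesis by (rule that[OF _ hL hL_inj _ hX hX_inj sq])
qed

lemma in_sigma_left_module: "in_sigma R M N \<Longrightarrow> left_module R N"
  by (simp add: in_sigma_def)

theorem projective_any:
  fixes M :: "('r, 'm) module"
  assumes M: "left_module R M" and proj: "projective_in_sigma R M"
    and s: "in_sigma R M K" "in_sigma R M L" "in_sigma R M X"
    and ex: "short_exact R K i L p X"
  shows "hom_exact R M K i L p X"
proof (rule hom_exactI[OF M ex])
  fix f assume f: "f \<in> mod_hom R M X"
  have p: "p \<in> mod_hom R L X" and onto: "p ` carrier L = carrier X"
    using ex unfolding short_exact_def by blast+
  have "\<exists>y. y \<in> carrier L \<and> p y = f m" if "m \<in> carrier M" for m
    using mod_homD(1)[OF f that] onto by (metis imageE)
  then obtain l where l: "\<And>m. m \<in> carrier M \<Longrightarrow> l m \<in> carrier L"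
    "\<And>m. m \<in> carrier M \<Longrightarrow> p (l m) = f m" by metis
  have lL: "l ` carrier M \<subseteq> carrier L" using l(1) by blast
  obtain K1 :: "('r, ('r, 'm) gen) module" and i1
    and L1 :: "('r, ('r, 'm) gen) module" and p1 and X1 :: "('r, ('r, 'm) gen) module" and hL hX
    where ex1: "short_exact R K1 i1 L1 p1 X1"
    and hL: "hL \<in> mod_hom R L1 L" "inj_on hL (carrier L1)" "l ` carrier M \<subseteq> hL ` carrier L1"
    and hX: "hX \<in> mod_hom R X1 X" "inj_on hX (carrier X1)"
    and sq: "\<And>y. y \<in> carrier L1 \<Longrightarrow> hX (p1 y) = p (hL y)"
    using small_short_exact[OF ex lL] by metis
  have m1: "left_module R K1" "left_module R L1" "left_module R X1"
    and i1: "i1 \<in> mod_hom R K1 L1" "inj_on i1 (carrier K1)" and p1: "p1 \<in> mod_hom R L1 X1"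
    using ex1 unfolding short_exact_def by blast+
  have sL1: "in_sigma R M L1" by (rule in_sigma_embed[OF M m1(2) s(2) hL(1,2)])
  have sX1: "in_sigma R M X1" by (rule in_sigma_embed[OF M m1(3) s(3) hX(1,2)])
  have sK1: "in_sigma R M K1" by (rule in_sigma_embed[OF M m1(1) sL1 i1])
  have "f ` carrier M \<subseteq> hX ` carrier X1"
  proof
    fix x assume "x \<in> f ` carrier M"
    then obtain m where m: "m \<in> carrier M" "x = f m" by blast
    then obtain y where "y \<in> carrier L1" "l m = hL y" using hL(3) by blast
    then show "x \<in> hX ` carrier X1"
      using sq[of y] l(2)[OF m(1)] m(2) mod_homD(1)[OF p1, of y] by (metis image_eqI)
  qed
  then obtain f1 where f1: "f1 \<in> mod_hom R M X1" "\<forall>m\<in>carrier M. hX (f1 m) = f m"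
    using mod_hom_lift[OF M m1(3) f hX] by blast
  have "hom_exact R M K1 i1 L1 p1 X1"
    using proj sK1 sL1 sX1 ex1 unfolding projective_in_sigma_def by blast
  then obtain g1 where g1: "g1 \<in> mod_hom R M L1" "f1 = compose (carrier M) p1 g1"
    using f1(1) unfolding hom_exact_def by blast
  have "p (hL (g1 m)) = f m" if "m \<in> carrier M" for m
    using f1(2) that sq[OF mod_homD(1)[OF g1(1) that]] g1(2) by (simp add: compose_apply)
  then show "\<exists>g\<in>mod_hom R M L. \<forall>m\<in>carrier M. p (g m) = f m"
    using mod_hom_compose[OF M g1(1) hL(1)] by (intro bexI) (auto simp: compose_apply)
qed

theorem M_singular_any:
  fixes M :: "('r, 'm) module" and X :: "('r, 'x) module"
  assumes M: "left_module R M"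
    and s: "in_sigma R M K" "in_sigma R M L" "in_sigma R M X"
    and ex: "short_exact R K i L p X" and ess: "essential R L (i ` carrier K)"
  shows "M_singular R M X"
proof -
  have L: "left_module R L" and X: "left_module R X"
    and p: "p \<in> mod_hom R L X" and onto: "p ` carrier L = carrier X"
    and ker: "i ` carrier K = mod_ker L X p"
    using ex unfolding short_exact_def by blast+
  define l where "l = inv_into (carrier L) p"
  have l: "l x \<in> carrier L" "p (l x) = x" if "x \<in> carrier X" for x
    using that onto by (simp_all add: l_def inv_into_into f_inv_into_f)
  have lL: "l ` carrier X \<subseteq> carrier L" using l(1) by blast
  obtain K1 :: "('r, ('r, 'x) gen) module" and i1
    and L1 :: "('r, ('r, 'x) gen) module" and p1 and X1 :: "('r, ('r, 'x) gen) module" and hL hX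
    where ex1: "short_exact R K1 i1 L1 p1 X1"
    and hL: "hL \<in> mod_hom R L1 L" "inj_on hL (carrier L1)" "l ` carrier X \<subseteq> hL ` carrier L1"
    and hX: "hX \<in> mod_hom R X1 X" "inj_on hX (carrier X1)"
    and sq: "\<And>y. y \<in> carrier L1 \<Longrightarrow> hX (p1 y) = p (hL y)"
    using small_short_exact[OF ex lL] by metis
  have m1: "left_module R K1" "left_module R L1" "left_module R X1"
    and i1: "i1 \<in> mod_hom R K1 L1" "inj_on i1 (carrier K1)" and p1: "p1 \<in> mod_hom R L1 X1"
    and ker1: "i1 ` carrier K1 = mod_ker L1 X1 p1"
    using ex1 unfolding short_exact_def by blast+
  interpret L1: left_module R L1 by (rule m1)
  interpret X1: left_module R X1 by (rule m1)
  have sL1: "in_sigma R M L1" by (rule in_sigma_embed[OF M m1(2) s(2) hL(1,2)])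
  have sK1: "in_sigma R M K1" by (rule in_sigma_embed[OF M m1(1) sL1 i1])
  let ?p = "compose (carrier L1) p hL"
  have p2: "?p \<in> mod_hom R L1 X" by (rule mod_hom_compose[OF m1(2) hL(1) p])
  have "x \<in> ?p ` carrier L1" if x: "x \<in> carrier X" for x
  proof -
    obtain y where "y \<in> carrier L1" "l x = hL y" using hL(3) x by blast
    then show ?thesis using l(2)[OF x] by (intro image_eqI[of _ _ y]) (simp_all add: compose_apply)
  qed
  then have onto2: "?p ` carrier L1 = carrier X" using mod_homD(1)[OF p2] by blast
  have p1z: "p1 y = \<zero>\<^bsub>X1\<^esub> \<longleftrightarrow> p (hL y) = \<zero>\<^bsub>X\<^esub>" if y: "y \<in> carrier L1" for y
    using sq[OF y] mod_hom_zero[OF m1(3) X hX(1)] inj_onD[OF hX(2), of "p1 y" "\<zero>\<^bsub>X1\<^esub>"]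
      mod_homD(1)[OF p1 y] by auto
  have ker2: "i1 ` carrier K1 = mod_ker L1 X ?p"
    unfolding ker1 mod_ker_def using p1z by (auto simp: compose_apply)
  have ex2: "short_exact R K1 i1 L1 ?p X"
    unfolding short_exact_def using m1 X i1 p2 onto2 ker2 by blast
  have hL0: "hL \<zero>\<^bsub>L1\<^esub> = \<zero>\<^bsub>L\<^esub>" by (rule mod_hom_zero[OF m1(2) L hL(1)])
  have ess1: "essential R L1 (i1 ` carrier K1)"
    unfolding essential_def
  proof (intro conjI allI impI)
    show "submodule (i1 ` carrier K1) R L1"
      unfolding ker1 by (rule submodule_ker[OF m1(2,3) p1])
    fix U assume "submodule U R L1 \<and> i1 ` carrier K1 \<inter> U = {\<zero>\<^bsub>L1\<^esub>}"
    then have U: "submodule U R L1" and int: "i1 ` carrier K1 \<inter> U = {\<zero>\<^bsub>L1\<^esub>}" by blast+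
    note UD = L1.submoduleD(1,2)[OF U]
    have hU: "submodule (hL ` U) R L" by (rule submodule_image[OF m1(2) L hL(1) U])
    have "i ` carrier K \<inter> hL ` U = {\<zero>\<^bsub>L\<^esub>}"
    proof (intro equalityI subsetI)
      fix y assume "y \<in> i ` carrier K \<inter> hL ` U"
      then obtain u where u: "u \<in> U" "y = hL u" "p (hL u) = \<zero>\<^bsub>X\<^esub>" by (auto simp: ker mod_ker_def)
      then have "u \<in> i1 ` carrier K1" using p1z UD(1) by (auto simp: ker1 mod_ker_def)
      then have "u = \<zero>\<^bsub>L1\<^esub>" using int u(1) by blast
      then show "y \<in> {\<zero>\<^bsub>L\<^esub>}" using u(2) hL0 by simp
    next
      fix y assume "y \<in> {\<zero>\<^bsub>L\<^esub>}"
      moreover have "\<zero>\<^bsub>L\<^esub> \<in> hL ` U" using UD(2) hL0 by (metis image_eqI)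
      moreover have "\<zero>\<^bsub>L\<^esub> \<in> i ` carrier K"
        unfolding ker mod_ker_def using hL0 mod_hom_zero[OF L X p] mod_homD(1)[OF hL(1), of "\<zero>\<^bsub>L1\<^esub>"]
        by simp
      ultimately show "y \<in> i ` carrier K \<inter> hL ` U" by blast
    qed
    then have "hL ` U = {\<zero>\<^bsub>L\<^esub>}" using ess hU unfolding essential_def by blast
    then have "u = \<zero>\<^bsub>L1\<^esub>" if "u \<in> U" for u
      using that hL0 inj_onD[OF hL(2), of u "\<zero>\<^bsub>L1\<^esub>"] UD by auto
    then show "U = {\<zero>\<^bsub>L1\<^esub>}" using UD(2) by blast
  qed
  show ?thesis unfolding M_singular_def using s(3) sK1 sL1 ex2 ess1 by blast
qed

definition power_single :: "'i set \<Rightarrow> ('r, 'm) module \<Rightarrow> 'i \<Rightarrow> 'm \<Rightarrow> 'i \<Rightarrow> 'm"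
  where "power_single I M i m = (\<lambda>k\<in>I. if k = i then m else \<zero>\<^bsub>M\<^esub>)"

lemma power_single_hom:
  assumes M: "left_module R M" and i: "i \<in> I"
  shows "(\<lambda>m\<in>carrier M. power_single I M i m) \<in> mod_hom R M (direct_power I M)"
proof -
  interpret M: left_module R M by fact
  show ?thesis
  proof (rule mod_homI)
    fix m assume "m \<in> carrier M"
    then show "(\<lambda>m\<in>carrier M. power_single I M i m) m \<in> carrier (direct_power I M)"
      unfolding power_single_def
      by (simp, intro M.direct_power_memI[of _ _ "{i}"]) auto
  qed (auto simp: power_single_def direct_power_def fun_eq_iff)
qed

lemma direct_power_hom_finsum:
  assumes M: "left_module R M" and N: "left_module R N"
    and q: "q \<in> mod_hom R (direct_power I M) N"
    and F: "finite F" "F \<subseteq> I"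
    and w: "w \<in> carrier (direct_power I M)" "\<And>i. i \<in> I - F \<Longrightarrow> w i = \<zero>\<^bsub>M\<^esub>"
  shows "q w = finsum N (\<lambda>i. q (power_single I M i (w i))) F"
proof -
  interpret M: left_module R M by fact
  interpret N: left_module R N by fact
  have P: "left_module R (direct_power I M)" by (rule M.left_module_direct_power)
  have sc: "power_single I M i m \<in> carrier (direct_power I M)" if "i \<in> I" "m \<in> carrier M" for i m
    using mod_homD(1)[OF power_single_hom[OF M that(1)] that(2)] that(2) by simp
  show ?thesis
    using F w
  proof (induction F arbitrary: w)
    case empty
    have "w = \<zero>\<^bsub>direct_power I M\<^esub>"
      using M.direct_power_memD(3)[OF empty(2)] empty(3)
      by (auto simp: direct_power_def fun_eq_iff split: if_splits)
    then show ?case using mod_hom_zero[OF P N q] by simp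
  next
    case (insert a F)
    note D = M.direct_power_memD[OF insert(5)]
    define w' where "w' = (\<lambda>k\<in>I. if k = a then \<zero>\<^bsub>M\<^esub> else w k)"
    have a: "a \<in> I" and FI: "F \<subseteq> I" using insert.prems by auto
    have w': "w' \<in> carrier (direct_power I M)"
      unfolding w'_def by (rule M.direct_power_memI[OF _ D(2)]) (use D(1) in auto)
    have z: "w' i = \<zero>\<^bsub>M\<^esub>" if "i \<in> I - F" for i
      using that insert.prems(3) by (auto simp: w'_def)
    have same: "w' i = w i" if "i \<in> F" for i
      using that FI insert(2) by (auto simp: w'_def)
    have "w = (\<lambda>k\<in>I. w k)" using D(3) by simp
    also have "\<dots> = power_single I M a (w a) \<oplus>\<^bsub>direct_power I M\<^esub> w'"
      unfolding direct_power_def power_single_def w'_def using D(1) a by (auto simp: fun_eq_iff)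
    finally have "q w = q (power_single I M a (w a)) \<oplus>\<^bsub>N\<^esub> q w'"
      using mod_homD(3)[OF q sc[OF a D(1)[OF a]] w'] by simp
    also have "q w' = finsum N (\<lambda>i. q (power_single I M i (w' i))) F"
      by (rule insert.IH[OF FI w' z])
    also have "\<dots> = finsum N (\<lambda>i. q (power_single I M i (w i))) F"
      using same mod_homD(1)[OF q sc] D(1) FI by (intro N.M.finsum_cong') auto
    also have "q (power_single I M a (w a)) \<oplus>\<^bsub>N\<^esub> \<dots> = finsum N (\<lambda>i. q (power_single I M i (w i))) (insert a F)"
      using insert(1,2) mod_homD(1)[OF q sc] D(1) FI a
      by (intro N.M.finsum_insert[symmetric]) auto
    finally show ?case .
  qed
qed

lemma (in left_module) finsum_smult:
  "finite F \<Longrightarrow> a \<in> carrier R \<Longrightarrow> f \<in> F \<rightarrow> carrier M \<Longrightarrow>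
    a \<odot>\<^bsub>M\<^esub> finsum M f F = finsum M (\<lambda>i. a \<odot>\<^bsub>M\<^esub> f i) F"
proof (induction F rule: finite_induct)
  case (insert x F)
  then have "f x \<in> carrier M" "f \<in> F \<rightarrow> carrier M" by auto
  then show ?case using insert by (simp add: smult_r_distr Pi_def)
qed simp

lemma sum_map_hom:
  assumes M: "left_module R M" and N: "left_module R N"
    and \<phi>: "\<And>i. i \<in> I \<Longrightarrow> \<phi> i \<in> mod_hom R M N"
  shows "(\<lambda>x\<in>carrier (direct_power I M). finsum N (\<lambda>i. \<phi> i (x i)) {i \<in> I. x i \<noteq> \<zero>\<^bsub>M\<^esub>})
    \<in> mod_hom R (direct_power I M) N" (is "(\<lambda>x\<in>?P. ?s x) \<in> _")
proof -
  interpret M: left_module R M by fact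
  interpret N: left_module R N by fact
  interpret P: left_module R "direct_power I M" by (rule M.left_module_direct_power)
  have c: "\<phi> i (x i) \<in> carrier N" if "i \<in> I" "x \<in> ?P" for i x
    by (rule mod_homD(1)[OF \<phi>[OF that(1)] M.direct_power_memD(1)[OF that(2,1)]])
  have ext: "?s x = finsum N (\<lambda>i. \<phi> i (x i)) F"
    if "x \<in> ?P" "finite F" "F \<subseteq> I" "{i \<in> I. x i \<noteq> \<zero>\<^bsub>M\<^esub>} \<subseteq> F" for x F
  proof (rule N.M.add.finprod_mono_neutral_cong_left[OF that(2,4)])
    show "\<phi> i (x i) = \<zero>\<^bsub>N\<^esub>" if "i \<in> F - {i \<in> I. x i \<noteq> \<zero>\<^bsub>M\<^esub>}" for i
    proof -
      have "i \<in> I" "x i = \<zero>\<^bsub>M\<^esub>" using that \<open>F \<subseteq> I\<close> by auto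
      then show ?thesis using mod_hom_zero[OF M N \<phi>] by simp
    qed
  qed (use c[OF _ \<open>x \<in> ?P\<close>] \<open>F \<subseteq> I\<close> in auto)
  show ?thesis
  proof (rule mod_homI)
    show "(\<lambda>x\<in>?P. ?s x) x \<in> carrier N" if "x \<in> ?P" for x
      using c[OF _ that] that by (auto intro!: N.M.finsum_closed)
  next
    fix x y assume x: "x \<in> ?P" and y: "y \<in> ?P"
    let ?F = "{i \<in> I. x i \<noteq> \<zero>\<^bsub>M\<^esub>} \<union> {i \<in> I. y i \<noteq> \<zero>\<^bsub>M\<^esub>}"
    have F: "finite ?F" "?F \<subseteq> I"
      using M.direct_power_memD(2)[OF x] M.direct_power_memD(2)[OF y] by auto
    have xy: "x \<oplus>\<^bsub>direct_power I M\<^esub> y \<in> ?P" using x y by (rule P.M.a_closed)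
    have val: "(x \<oplus>\<^bsub>direct_power I M\<^esub> y) i = x i \<oplus>\<^bsub>M\<^esub> y i" if "i \<in> I" for i
      using that by (simp add: direct_power_def)
    have sub: "{i \<in> I. (x \<oplus>\<^bsub>direct_power I M\<^esub> y) i \<noteq> \<zero>\<^bsub>M\<^esub>} \<subseteq> ?F"
      using val by auto
    have "?s (x \<oplus>\<^bsub>direct_power I M\<^esub> y) = finsum N (\<lambda>i. \<phi> i ((x \<oplus>\<^bsub>direct_power I M\<^esub> y) i)) ?F"
      by (rule ext[OF xy F sub])
    also have "\<dots> = finsum N (\<lambda>i. \<phi> i (x i) \<oplus>\<^bsub>N\<^esub> \<phi> i (y i)) ?F"
    proof (rule N.M.finsum_cong')
      fix i assume "i \<in> ?F"
      then have i: "i \<in> I" by auto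
      show "\<phi> i ((x \<oplus>\<^bsub>direct_power I M\<^esub> y) i) = \<phi> i (x i) \<oplus>\<^bsub>N\<^esub> \<phi> i (y i)"
        unfolding val[OF i]
        by (rule mod_homD(3)[OF \<phi>[OF i] M.direct_power_memD(1)[OF x i] M.direct_power_memD(1)[OF y i]])
    qed (use c[OF _ x] c[OF _ y] in auto)
    also have "\<dots> = finsum N (\<lambda>i. \<phi> i (x i)) ?F \<oplus>\<^bsub>N\<^esub> finsum N (\<lambda>i. \<phi> i (y i)) ?F"
      by (rule N.M.finsum_addf) (use c[OF _ x] c[OF _ y] in auto)
    also have "\<dots> = ?s x \<oplus>\<^bsub>N\<^esub> ?s y"
      using ext[OF x F] ext[OF y F] by simp
    finally show "(\<lambda>x\<in>?P. ?s x) (x \<oplus>\<^bsub>direct_power I M\<^esub> y) = (\<lambda>x\<in>?P. ?s x) x \<oplus>\<^bsub>N\<^esub> (\<lambda>x\<in>?P. ?s x) y"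
      using x y xy by simp
  next
    fix r x assume r: "r \<in> carrier R" and x: "x \<in> ?P"
    let ?F = "{i \<in> I. x i \<noteq> \<zero>\<^bsub>M\<^esub>}"
    have F: "finite ?F" "?F \<subseteq> I"
      using M.direct_power_memD(2)[OF x] by auto
    have rx: "r \<odot>\<^bsub>direct_power I M\<^esub> x \<in> ?P" using r x by (rule P.smult_closed)
    have val: "(r \<odot>\<^bsub>direct_power I M\<^esub> x) i = r \<odot>\<^bsub>M\<^esub> x i" if "i \<in> I" for i
      using that by (simp add: direct_power_def)
    have sub: "{i \<in> I. (r \<odot>\<^bsub>direct_power I M\<^esub> x) i \<noteq> \<zero>\<^bsub>M\<^esub>} \<subseteq> ?F"
      using val r by auto
    have "?s (r \<odot>\<^bsub>direct_power I M\<^esub> x) = finsum N (\<lambda>i. \<phi> i ((r \<odot>\<^bsub>direct_power I M\<^esub> x) i)) ?F"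
      by (rule ext[OF rx F sub])
    also have "\<dots> = finsum N (\<lambda>i. r \<odot>\<^bsub>N\<^esub> \<phi> i (x i)) ?F"
    proof (rule N.M.finsum_cong')
      fix i assume "i \<in> ?F"
      then have i: "i \<in> I" by auto
      show "\<phi> i ((r \<odot>\<^bsub>direct_power I M\<^esub> x) i) = r \<odot>\<^bsub>N\<^esub> \<phi> i (x i)"
        unfolding val[OF i]
        by (rule mod_homD(4)[OF \<phi>[OF i] r M.direct_power_memD(1)[OF x i]])
    qed (use c[OF _ x] r in auto)
    also have "\<dots> = r \<odot>\<^bsub>N\<^esub> ?s x"
      by (rule N.finsum_smult[OF F(1) r, symmetric]) (use c[OF _ x] in auto)
    finally show "(\<lambda>x\<in>?P. ?s x) (r \<odot>\<^bsub>direct_power I M\<^esub> x) = r \<odot>\<^bsub>N\<^esub> (\<lambda>x\<in>?P. ?s x) x"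
      using x rx by simp
  qed simp
qed

theorem generator_any:
  fixes M :: "('r, 'm) module" and N :: "('r, 'n) module"
  assumes M: "left_module R M" and gen: "generator_in_sigma R M" and s: "in_sigma R M N"
  shows "\<exists>(I :: ('n \<times> nat) set) p. p \<in> mod_hom R (direct_power I M) N \<and>
    p ` carrier (direct_power I M) = carrier N"
proof -
  have N: "left_module R N" by (rule in_sigma_left_module[OF s])
  interpret M: left_module R M by fact
  interpret N: left_module R N by fact
  have trace: "\<exists>(k :: nat) \<phi> m. (\<forall>i<k. \<phi> i \<in> mod_hom R M N \<and> m i \<in> carrier M) \<and>
      n = finsum N (\<lambda>i. \<phi> i (m i)) {..<k}" if n: "n \<in> carrier N" for n
  proof -
    let ?l = "\<lambda>_ :: 'm. n"
    have l: "?l ` {undefined} \<subseteq> carrier N" using n by simp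
    define H where "H = mod_span R N {n}"
    have H: "submodule H R N" and nH: "n \<in> H"
      using N.submodule_mod_span[of "{n}"] n by (simp_all add: H_def)
    obtain g :: "'n \<Rightarrow> ('r, 'm) gen" where g: "inj_on g H"
      using N.span_gen[OF l] by (auto simp: H_def)
    obtain C :: "('r, ('r, 'm) gen) module" where C: "left_module R C" "carrier C = g ` H"
        "restrict (inv_into H g) (carrier C) \<in> mod_hom R C N"
      by (rule transport_submod[OF N H g])
    define h where "h = restrict (inv_into H g) (carrier C)"
    have h: "h \<in> mod_hom R C N" unfolding h_def by (rule C(3))
    have h_inj: "inj_on h (carrier C)"
      using inj_on_inv_into[of "carrier C" g H] C(2) by (simp add: h_def)
    have hg: "h (g n) = n" "g n \<in> carrier C" using nH g C(2) by (simp_all add: h_def)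
    have sC: "in_sigma R M C" by (rule in_sigma_embed[OF M C(1) s h h_inj])
    then obtain J :: "(('r, 'm) gen \<times> nat) set" and q where
        q: "q \<in> mod_hom R (direct_power J M) C" "q ` carrier (direct_power J M) = carrier C"
      using gen unfolding generator_in_sigma_def by metis
    have "g n \<in> q ` carrier (direct_power J M)" using q(2) hg(2) by simp
    then obtain w where w: "w \<in> carrier (direct_power J M)" "q w = g n" by fastforce
    note D = M.direct_power_memD[OF w(1)]
    have PJ: "left_module R (direct_power J M)" by (rule M.left_module_direct_power)
    let ?q = "compose (carrier (direct_power J M)) h q"
    have q': "?q \<in> mod_hom R (direct_power J M) N" by (rule mod_hom_compose[OF PJ q(1) h])
    define F where "F = {i \<in> J. w i \<noteq> \<zero>\<^bsub>M\<^esub>}"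
    have F: "finite F" "F \<subseteq> J" using D(2) by (auto simp: F_def)
    define \<phi> where "\<phi> i = compose (carrier M) ?q (\<lambda>m\<in>carrier M. power_single J M i m)" for i
    have \<phi>: "\<phi> i \<in> mod_hom R M N" if "i \<in> J" for i
      unfolding \<phi>_def by (rule mod_hom_compose[OF M power_single_hom[OF M that] q'])
    have \<phi>_ap: "\<phi> i m = ?q (power_single J M i m)" if "m \<in> carrier M" for i m
      using that by (simp add: \<phi>_def compose_apply)
    have \<phi>c: "\<phi> i (w i) \<in> carrier N" if "i \<in> F" for i
      using mod_homD(1)[OF \<phi> D(1)] that F(2) by blast
    have "n = ?q w" using w(1) hg(1) by (simp add: compose_apply w(2))
    also have "\<dots> = finsum N (\<lambda>i. ?q (power_single J M i (w i))) F"
      by (rule direct_power_hom_finsum[OF M N q' F w(1)]) (auto simp: F_def)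
    also have "\<dots> = finsum N (\<lambda>i. \<phi> i (w i)) F"
      using \<phi>_ap D(1) F(2) \<phi>c by (intro N.M.finsum_cong') (auto simp: subset_iff)
    finally have eq: "n = finsum N (\<lambda>i. \<phi> i (w i)) F" .
    obtain b where b: "bij_betw b {..<card F} F"
      using ex_bij_betw_nat_finite[OF F(1)] by (auto simp: atLeast0LessThan)
    have bF: "b i \<in> F" if "i < card F" for i using b that by (auto simp: bij_betw_def)
    have "finsum N (\<lambda>i. \<phi> i (w i)) (b ` {..<card F}) = finsum N (\<lambda>i. \<phi> (b i) (w (b i))) {..<card F}"
      using b bF \<phi>c by (intro N.M.finsum_reindex) (auto simp: bij_betw_def)
    then have "n = finsum N (\<lambda>i. \<phi> (b i) (w (b i))) {..<card F}"
      using eq b by (simp add: bij_betw_def)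
    moreover have "\<forall>i<card F. \<phi> (b i) \<in> mod_hom R M N \<and> w (b i) \<in> carrier M"
      using bF F(2) \<phi> D(1) by blast
    ultimately show ?thesis
      by (intro exI[of _ "card F"] exI[of _ "\<lambda>i. \<phi> (b i)"] exI[of _ "\<lambda>i. w (b i)"] conjI)
  qed
  define T where "T n k \<phi> m \<longleftrightarrow> (\<forall>i<k. \<phi> i \<in> mod_hom R M N \<and> m i \<in> carrier M) \<and>
    n = finsum N (\<lambda>i. \<phi> i (m i)) {..<k}" for n and k :: nat and \<phi> m
  have "\<exists>k \<phi> m. T n k \<phi> m" if "n \<in> carrier N" for n
    using trace[OF that] by (simp add: T_def)
  then obtain k \<phi> m where T: "\<And>n. n \<in> carrier N \<Longrightarrow> T n (k n) (\<phi> n) (m n)"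
    by metis
  have tr: "\<And>n i. n \<in> carrier N \<Longrightarrow> i < k n \<Longrightarrow> \<phi> n i \<in> mod_hom R M N"
      "\<And>n i. n \<in> carrier N \<Longrightarrow> i < k n \<Longrightarrow> m n i \<in> carrier M"
      "\<And>n. n \<in> carrier N \<Longrightarrow> n = finsum N (\<lambda>i. \<phi> n i (m n i)) {..<k n}"
    using T unfolding T_def by blast+
  define I where "I = (SIGMA n:carrier N. {..<k n})"
  let ?P = "direct_power I M"
  let ?s = "\<lambda>x. finsum N (\<lambda>i. \<phi> (fst i) (snd i) (x i)) {i \<in> I. x i \<noteq> \<zero>\<^bsub>M\<^esub>}"
  have p: "(\<lambda>x\<in>carrier ?P. ?s x) \<in> mod_hom R ?P N"
    by (rule sum_map_hom[OF M N]) (auto simp: I_def tr(1))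
  have "n \<in> (\<lambda>x\<in>carrier ?P. ?s x) ` carrier ?P" if n: "n \<in> carrier N" for n
  proof -
    define x where "x = (\<lambda>i\<in>I. if fst i = n then m n (snd i) else \<zero>\<^bsub>M\<^esub>)"
    have x: "x \<in> carrier ?P"
      unfolding x_def
      by (rule M.direct_power_memI[of _ _ "Pair n ` {..<k n}"]) (auto simp: I_def tr(2))
    have sub: "{i \<in> I. x i \<noteq> \<zero>\<^bsub>M\<^esub>} \<subseteq> Pair n ` {..<k n}" by (auto simp: x_def I_def)
    have xn: "x (n, i) = m n i" if "i < k n" for i using that n by (simp add: x_def I_def)
    have c: "\<phi> n i (m n i) \<in> carrier N" if "i < k n" for i
      by (rule mod_homD(1)[OF tr(1)[OF n that] tr(2)[OF n that]])
    have "?s x = finsum N (\<lambda>i. \<phi> (fst i) (snd i) (x i)) (Pair n ` {..<k n})"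
    proof (rule N.M.add.finprod_mono_neutral_cong_left[OF _ sub])
      fix j assume "j \<in> Pair n ` {..<k n} - {i \<in> I. x i \<noteq> \<zero>\<^bsub>M\<^esub>}"
      then obtain i where i: "j = (n, i)" "i < k n" "x (n, i) = \<zero>\<^bsub>M\<^esub>"
        using n by (auto simp: I_def)
      then show "\<phi> (fst j) (snd j) (x j) = \<zero>\<^bsub>N\<^esub>"
        using mod_hom_zero[OF M N tr(1)[OF n i(2)]] by simp
    qed (use c xn in auto)
    also have "\<dots> = finsum N (\<lambda>i. \<phi> n i (x (n, i))) {..<k n}"
      using c xn by (subst N.M.finsum_reindex) (auto simp: inj_on_def)
    also have "\<dots> = finsum N (\<lambda>i. \<phi> n i (m n i)) {..<k n}"
      using c xn by (intro N.M.finsum_cong') auto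
    also have "\<dots> = n" by (rule tr(3)[OF n, symmetric])
    finally show ?thesis using x by (intro image_eqI[of _ _ x]) simp_all
  qed
  then have "(\<lambda>x\<in>carrier ?P. ?s x) ` carrier ?P = carrier N"
    using mod_homD(1)[OF p] by (intro equalityI subsetI) auto
  then show ?thesis using p by (intro exI[of _ I] exI[of _ "\<lambda>x\<in>carrier ?P. ?s x"] conjI)
qed

end

theory Submission
  imports Defs "HOL-Algebra.AbelCoset"
begin

text \<open>
  A homomorphism from a submodule of \<open>M\<close> to a non \<open>M\<close>-singular module \<open>A\<close> vanishes as soon as its
  kernel is essential, because its image is then \<open>M\<close>-singular. Let \<open>K\<close> be the reject of \<open>A\<close> in \<open>M\<close>,
  the common kernel of all homomorphisms \<open>M \<rightarrow> A\<close>. Two consequences: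

  (1) Every \<open>f : U \<rightarrow> A\<close> with \<open>U \<le> M\<close> vanishes on \<open>V = U \<inter> K\<close>. Indeed, for \<open>g : M \<rightarrow> V\<close> the composite
  \<open>f g\<close> kills \<open>K\<close>, so a submodule \<open>X \<le> V\<close> on which \<open>f\<close> is injective satisfies \<open>g(X) = 0\<close> for all
  \<open>g : M \<rightarrow> X\<close>; semiprimeness and projectivity give \<open>X = 0\<close>, and \<open>ker f\<close> is essential in \<open>V\<close>.

  (2) \<open>K\<close> is the common kernel of finitely many homomorphisms \<open>M \<rightarrow> A\<close>, because \<open>M\<close> has finite uniform
  dimension.

  By (1) and (2), \<open>f\<close> factors through a submodule of a finite power of \<open>A\<close>, and quasi-injective modules
  are injective relative to their finite powers.
\<close>

section \<open>Sums and differences of homomorphisms\<close>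

lemma mod_hom_add:
  assumes N: "left_module R N" and M: "left_module R M"
    and f: "f \<in> mod_hom R M N" and g: "g \<in> mod_hom R M N"
  shows "(\<lambda>x\<in>carrier M. f x \<oplus>\<^bsub>N\<^esub> g x) \<in> mod_hom R M N"
proof -
  interpret N: left_module R N by fact
  interpret M: left_module R M by fact
  show ?thesis
    by (rule mod_homI)
      (simp_all add: mod_homD[OF f] mod_homD[OF g] N.smult_r_distr N.M.a_ac)
qed

lemma mod_hom_minus:
  assumes N: "left_module R N" and M: "left_module R M"
    and f: "f \<in> mod_hom R M N" and g: "g \<in> mod_hom R M N"
  shows "(\<lambda>x\<in>carrier M. f x \<ominus>\<^bsub>N\<^esub> g x) \<in> mod_hom R M N"
proof -
  interpret N: left_module R N by fact
  interpret M: left_module R M by fact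
  have sm: "r \<odot>\<^bsub>N\<^esub> (\<ominus>\<^bsub>N\<^esub> y) = \<ominus>\<^bsub>N\<^esub> (r \<odot>\<^bsub>N\<^esub> y)" if "r \<in> carrier R" "y \<in> carrier N" for r y
  proof -
    have "r \<odot>\<^bsub>N\<^esub> (\<ominus>\<^bsub>N\<^esub> y) \<oplus>\<^bsub>N\<^esub> r \<odot>\<^bsub>N\<^esub> y = \<zero>\<^bsub>N\<^esub>"
      using that by (simp add: N.smult_r_distr[symmetric] N.M.l_neg)
    then show ?thesis using that by (simp add: N.M.minus_equality)
  qed
  have neg: "(\<lambda>x\<in>carrier M. \<ominus>\<^bsub>N\<^esub> g x) \<in> mod_hom R M N"
    by (rule mod_homI) (simp_all add: mod_homD[OF g] sm N.M.minus_add)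
  show ?thesis
    using mod_hom_add[OF N M f neg] by (simp add: a_minus_def cong: restrict_cong)
qed

lemma mod_hom_a_minus:
  assumes M: "left_module R M" and N: "left_module R N" and f: "f \<in> mod_hom R M N"
    and x: "x \<in> carrier M" and y: "y \<in> carrier M"
  shows "f (x \<ominus>\<^bsub>M\<^esub> y) = f x \<ominus>\<^bsub>N\<^esub> f y"
proof -
  interpret M: left_module R M by fact
  interpret N: left_module R N by fact
  note F = mod_homD[OF f]
  have "x = (x \<ominus>\<^bsub>M\<^esub> y) \<oplus>\<^bsub>M\<^esub> y"
    using x y by (simp add: a_minus_def M.M.a_assoc M.M.l_neg)
  then have "f x = f (x \<ominus>\<^bsub>M\<^esub> y) \<oplus>\<^bsub>N\<^esub> f y"
    using F(3)[of "x \<ominus>\<^bsub>M\<^esub> y" y] x y by simp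
  then show ?thesis
    using F(1)[of "x \<ominus>\<^bsub>M\<^esub> y"] F(1)[OF x] F(1)[OF y] x y
    by (simp add: a_minus_def N.M.a_assoc N.M.r_neg)
qed

section \<open>Submodules, direct powers and membership in \<sigma>[M]\<close>

context left_module
begin

lemma a_minus_submodule:
  "submodule H R M \<Longrightarrow> x \<in> H \<Longrightarrow> y \<in> H \<Longrightarrow> x \<ominus>\<^bsub>M\<^esub> y \<in> H"
  by (simp add: a_minus_def submoduleD(3,5))

lemma submodule_Int:
  "submodule H R M \<Longrightarrow> submodule K R M \<Longrightarrow> submodule (H \<inter> K) R M"
  by (rule submoduleI) (auto simp: submoduleD(2-4) dest: submoduleD(1))

lemma submodule_set_add:
  assumes H: "submodule H R M" and K: "submodule K R M"
  shows "submodule (H <+>\<^bsub>M\<^esub> K) R M"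
proof -
  note DH = submoduleD[OF H] and DK = submoduleD[OF K]
  have mem: "z \<in> H <+>\<^bsub>M\<^esub> K \<longleftrightarrow> (\<exists>x\<in>H. \<exists>y\<in>K. z = x \<oplus>\<^bsub>M\<^esub> y)" for z
    by (auto simp: set_add_def set_mult_def)
  show ?thesis
  proof (rule submoduleI)
    show "H <+>\<^bsub>M\<^esub> K \<subseteq> carrier M" using DH(1) DK(1) by (auto simp: mem subset_iff)
    show "\<zero>\<^bsub>M\<^esub> \<in> H <+>\<^bsub>M\<^esub> K" unfolding mem using DH(2) DK(2) by (metis M.l_zero M.zero_closed)
  next
    fix a b assume "a \<in> H <+>\<^bsub>M\<^esub> K" "b \<in> H <+>\<^bsub>M\<^esub> K"
    then obtain x y x' y' where *: "x \<in> H" "y \<in> K" "x' \<in> H" "y' \<in> K"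
      "a = x \<oplus>\<^bsub>M\<^esub> y" "b = x' \<oplus>\<^bsub>M\<^esub> y'" by (auto simp: mem)
    then have "a \<oplus>\<^bsub>M\<^esub> b = (x \<oplus>\<^bsub>M\<^esub> x') \<oplus>\<^bsub>M\<^esub> (y \<oplus>\<^bsub>M\<^esub> y')"
      using DH(1) DK(1) by (simp add: subset_iff M.a_ac)
    then show "a \<oplus>\<^bsub>M\<^esub> b \<in> H <+>\<^bsub>M\<^esub> K" unfolding mem using * DH(3) DK(3) by blast
  next
    fix r z assume r: "r \<in> carrier R" and "z \<in> H <+>\<^bsub>M\<^esub> K"
    then obtain x y where *: "x \<in> H" "y \<in> K" "z = x \<oplus>\<^bsub>M\<^esub> y" by (auto simp: mem)
    then have "r \<odot>\<^bsub>M\<^esub> z = r \<odot>\<^bsub>M\<^esub> x \<oplus>\<^bsub>M\<^esub> r \<odot>\<^bsub>M\<^esub> y"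
      using r DH(1) DK(1) by (simp add: subset_iff smult_r_distr)
    then show "r \<odot>\<^bsub>M\<^esub> z \<in> H <+>\<^bsub>M\<^esub> K" unfolding mem using * r DH(4) DK(4) by blast
  qed
qed

lemma set_addI: "x \<in> H \<Longrightarrow> y \<in> K \<Longrightarrow> x \<oplus>\<^bsub>M\<^esub> y \<in> H <+>\<^bsub>M\<^esub> K"
  by (auto simp: set_add_def set_mult_def)

lemma set_addE:
  assumes "z \<in> H <+>\<^bsub>M\<^esub> K"
  obtains x y where "x \<in> H" "y \<in> K" "z = x \<oplus>\<^bsub>M\<^esub> y"
  using assms by (auto simp: set_add_def set_mult_def)

lemma submodule_submodD:
  assumes L: "submodule L R M" and X: "submodule X R (submod M L)"
  shows "submodule X R M" "X \<subseteq> L"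
proof -
  note D = left_module.submoduleD[OF left_module_submod[OF L] X]
  show "X \<subseteq> L" using D(1) by simp
  then show "submodule X R M"
    using D submoduleD(1)[OF L] by (intro submoduleI) auto
qed

lemma submodule_submodI:
  assumes L: "submodule L R M" and X: "submodule X R M" "X \<subseteq> L"
  shows "submodule X R (submod M L)"
  using submoduleD[OF X(1)] X(2)
  by (intro left_module.submoduleI[OF left_module_submod[OF L]]) auto

lemma power_proj_hom:
  assumes i: "i \<in> I"
  shows "(\<lambda>x\<in>carrier (direct_power I M). x i) \<in> mod_hom R (direct_power I M) M"
proof -
  interpret P: left_module R "direct_power I M" by (rule left_module_direct_power)
  show ?thesis
  proof (rule mod_homI)
    fix x y assume x: "x \<in> carrier (direct_power I M)" and y: "y \<in> carrier (direct_power I M)"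
    have "x \<oplus>\<^bsub>direct_power I M\<^esub> y \<in> carrier (direct_power I M)" using x y by (rule P.M.a_closed)
    then show "(\<lambda>x\<in>carrier (direct_power I M). x i) (x \<oplus>\<^bsub>direct_power I M\<^esub> y) =
      (\<lambda>x\<in>carrier (direct_power I M). x i) x \<oplus>\<^bsub>M\<^esub> (\<lambda>x\<in>carrier (direct_power I M). x i) y"
      using x y i by simp (simp add: direct_power_def)
  next
    fix r x assume r: "r \<in> carrier R" and x: "x \<in> carrier (direct_power I M)"
    have "r \<odot>\<^bsub>direct_power I M\<^esub> x \<in> carrier (direct_power I M)" using r x by (rule P.smult_closed)
    then show "(\<lambda>x\<in>carrier (direct_power I M). x i) (r \<odot>\<^bsub>direct_power I M\<^esub> x) =
      r \<odot>\<^bsub>M\<^esub> (\<lambda>x\<in>carrier (direct_power I M). x i) x"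
      using x i by simp (simp add: direct_power_def)
  qed (use i direct_power_memD in auto)
qed

lemma in_sigma_self: "in_sigma R M M"
proof -
  have M: "left_module R M" by (rule left_module_axioms)
  \<comment> \<open>\<open>M\<close> is the image of its power over the one-point index set under
    the only projection.\<close>
  let ?P = "direct_power {()} M" and ?p = "\<lambda>x\<in>carrier (direct_power {()} M). x ()"
  have p: "?p \<in> mod_hom R ?P M" by (rule power_proj_hom) simp
  have "m \<in> ?p ` carrier ?P" if m: "m \<in> carrier M" for m
  proof -
    have "power_single {()} M () m \<in> carrier ?P"
      using mod_homD(1)[OF power_single_hom[OF M, of "()" "{()}"] m] m by simp
    then show ?thesis
      by (intro image_eqI[of _ _ "power_single {()} M () m"]) (simp_all add: power_single_def)
  qed
  then have onto: "?p ` carrier ?P = carrier M" using mod_homD(1)[OF p] by blast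
  have "(\<lambda>x\<in>carrier M. x) \<in> mod_hom R M M"
    using mod_hom_incl[OF M submodule_carrier[OF M]] by simp
  then show ?thesis
    by (rule in_sigma_any[OF M M M p onto]) (simp add: inj_on_def)
qed

lemma in_sigma_submodule: "submodule L R M \<Longrightarrow> in_sigma R M (submod M L)"
  by (rule in_sigma_embed[OF left_module_axioms left_module_submod in_sigma_self
        mod_hom_incl[OF left_module_axioms]])
    (simp_all add: inj_on_def)

text \<open>The power of \<open>X\<close> embeds in the power of \<open>M\<close>, which is a
  quotient of itself via the identity. Projectivity in \<sigma>[M] can therefore be applied to maps
  out of a direct sum of copies of \<open>X\<close>.\<close>

lemma in_sigma_direct_power:
  assumes X: "submodule X R M"
  shows "in_sigma R M (direct_power I (submod M X))"
proof -
  have M: "left_module R M" by (rule left_module_axioms)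
  let ?P = "direct_power I M" and ?X = "direct_power I (submod M X)"
  have P: "left_module R ?P" by (rule left_module_direct_power)
  interpret X: left_module R "submod M X" by (rule left_module_submod[OF X])
  have XP: "left_module R ?X" by (rule X.left_module_direct_power)
  interpret XP: left_module R ?X by (rule XP)
  have sub: "carrier ?X \<subseteq> carrier ?P"
    using submoduleD(1)[OF X] by (auto simp: direct_power_def)
  have "(\<lambda>x\<in>carrier ?P. x) \<in> mod_hom R ?P ?P"
    using mod_hom_incl[OF P submodule_carrier[OF P]] by simp
  moreover have "(\<lambda>x\<in>carrier ?P. x) ` carrier ?P = carrier ?P" by simp
  moreover have "(\<lambda>x\<in>carrier ?X. x) \<in> mod_hom R ?X ?P"
  proof (rule mod_homI)
    fix x y assume x: "x \<in> carrier ?X" and y: "y \<in> carrier ?X"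
    have "x \<oplus>\<^bsub>?X\<^esub> y \<in> carrier ?X" using x y by (rule XP.M.a_closed)
    then show "(\<lambda>x\<in>carrier ?X. x) (x \<oplus>\<^bsub>?X\<^esub> y) = (\<lambda>x\<in>carrier ?X. x) x \<oplus>\<^bsub>?P\<^esub> (\<lambda>x\<in>carrier ?X. x) y"
      using x y by simp (simp add: direct_power_def)
  next
    fix r x assume r: "r \<in> carrier R" and x: "x \<in> carrier ?X"
    have "r \<odot>\<^bsub>?X\<^esub> x \<in> carrier ?X" using r x by (rule XP.smult_closed)
    then show "(\<lambda>x\<in>carrier ?X. x) (r \<odot>\<^bsub>?X\<^esub> x) = r \<odot>\<^bsub>?P\<^esub> (\<lambda>x\<in>carrier ?X. x) x"
      using x by simp (simp add: direct_power_def)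
  qed (use sub in auto)
  ultimately show ?thesis
    by (rule in_sigma_any[OF M XP P]) (simp add: inj_on_def)
qed

end

section \<open>Essential kernels and M-singular images\<close>

lemma short_exact_ker:
  assumes L: "left_module R L" and X: "left_module R X"
    and p: "p \<in> mod_hom R L X" "p ` carrier L = carrier X"
  shows "short_exact R (submod L (mod_ker L X p)) (\<lambda>x\<in>mod_ker L X p. x) L p X"
proof -
  interpret L: left_module R L by fact
  have K: "submodule (mod_ker L X p) R L" by (rule submodule_ker[OF L X p(1)])
  show ?thesis
    unfolding short_exact_def
    by (intro conjI L.left_module_submod[OF K] L X p mod_hom_incl[OF L K]) (simp_all add: inj_on_def)
qed

lemma submodule_preimage:
  assumes M: "left_module R M" and N: "left_module R N" and f: "f \<in> mod_hom R M N"
    and H: "submodule H R N"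
  shows "submodule {x \<in> carrier M. f x \<in> H} R M"
proof -
  interpret M: left_module R M by fact
  interpret N: left_module R N by fact
  note D = N.submoduleD[OF H]
  show ?thesis
    by (rule M.submoduleI) (use D in \<open>auto simp: mod_homD[OF f] mod_hom_zero[OF M N f]\<close>)
qed

text \<open>The hypothesis \<open>ess\<close> is essentiality of the kernel in elementwise form: a
  submodule of \<open>L\<close> on which \<open>f\<close> is injective is zero. Then 0 \<rightarrow>
  ker f \<rightarrow> L \<rightarrow> f(L) \<rightarrow> 0 shows that f(L) is M-singular, so f(L)
  lies in the singular part of \<open>A\<close>, which is zero.\<close>

lemma hom_vanishes_if_ker_essential:
  assumes M: "left_module R M" and A: "in_sigma R M A" and ns: "non_M_singular R M A"
    and L: "submodule L R M" and f: "f \<in> mod_hom R (submod M L) A"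
    and ess: "\<And>X. submodule X R M \<Longrightarrow> X \<subseteq> L \<Longrightarrow>
      (\<And>x. x \<in> X \<Longrightarrow> f x = \<zero>\<^bsub>A\<^esub> \<Longrightarrow> x = \<zero>\<^bsub>M\<^esub>) \<Longrightarrow> X \<subseteq> {\<zero>\<^bsub>M\<^esub>}"
    and x: "x \<in> L"
  shows "f x = \<zero>\<^bsub>A\<^esub>"
proof -
  interpret M: left_module R M by fact
  have A': "left_module R A" by (rule in_sigma_left_module[OF A])
  interpret A: left_module R A by (rule A')
  let ?L = "submod M L"
  have lL: "left_module R ?L" by (rule M.left_module_submod[OF L])
  interpret L: left_module R ?L by (rule lL)
  define Y where "Y = f ` L"
  have Y: "submodule Y R A"
    using submodule_image[OF lL A' f submodule_carrier[OF lL]] by (simp add: Y_def)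
  have lY: "left_module R (submod A Y)" by (rule A.left_module_submod[OF Y])
  have f': "f \<in> mod_hom R ?L (submod A Y)" by (rule mod_hom_submod[OF f]) (simp add: Y_def)
  let ?K = "mod_ker ?L (submod A Y) f"
  have K: "submodule ?K R ?L" by (rule submodule_ker[OF lL lY f'])
  have ex: "short_exact R (submod ?L ?K) (\<lambda>x\<in>?K. x) ?L f (submod A Y)"
    by (rule short_exact_ker[OF lL lY f']) (simp add: Y_def)
  have sL: "in_sigma R M ?L" by (rule M.in_sigma_submodule[OF L])
  have sK: "in_sigma R M (submod ?L ?K)"
    by (rule in_sigma_embed[OF M L.left_module_submod[OF K] sL mod_hom_incl[OF lL K]])
      (simp add: inj_on_def)
  have sY: "in_sigma R M (submod A Y)"
    by (rule in_sigma_embed[OF M lY A mod_hom_incl[OF A' Y]]) (simp add: inj_on_def)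
  have "essential R ?L ?K"
    unfolding essential_def
  proof (intro conjI allI impI K)
    fix X assume "submodule X R ?L \<and> ?K \<inter> X = {\<zero>\<^bsub>?L\<^esub>}"
    then have X: "submodule X R ?L" and int: "?K \<inter> X = {\<zero>\<^bsub>M\<^esub>}" by simp_all
    note X' = M.submodule_submodD[OF L X]
    have "X \<subseteq> {\<zero>\<^bsub>M\<^esub>}"
      by (rule ess[OF X']) (use int X'(2) in \<open>auto simp: mod_ker_def\<close>)
    then show "X = {\<zero>\<^bsub>?L\<^esub>}" using M.submoduleD(2)[OF X'(1)] by auto
  qed
  then have "essential R ?L ((\<lambda>x\<in>?K. x) ` carrier (submod ?L ?K))" by simp
  \<comment> \<open>The sequence lives on the carrier types of \<open>M\<close> and
    \<open>A\<close>; \<open>M_singular_any\<close> moves it to the types fixed in the definition of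
    \<open>M_singular\<close>.\<close>
  then have sing: "M_singular R M (submod A Y)"
    by (rule M_singular_any[OF M sK sL sY ex])
  have "Y \<subseteq> singular_part R M A"
    unfolding singular_part_def submod_sum_def mod_span_def using Y sing by blast
  then show ?thesis using ns x by (auto simp: non_M_singular_def Y_def)
qed

section \<open>Semiprimeness for arbitrary submodules\<close>

text \<open>
  Semiprimeness speaks about fully invariant submodules only, so it is applied to the sum \<open>T\<close> of all
  images \<open>\<phi>(X)\<close>, \<open>\<phi> \<in> End(M)\<close>; projectivity lifts each \<open>M \<rightarrow> T\<close> to the direct sum of copies of \<open>X\<close>
  indexed by \<open>End(M)\<close>.
\<close>

lemma semiprime_self_annihilating:
  fixes M :: "('r, 'm) module"
  assumes M: "left_module R M" and proj: "projective_in_sigma R M" and sp: "semiprime_module R M"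
    and X: "submodule X R M"
    and ann: "\<And>g x. g \<in> mod_hom R M (submod M X) \<Longrightarrow> x \<in> X \<Longrightarrow> g x = \<zero>\<^bsub>M\<^esub>"
  shows "X = {\<zero>\<^bsub>M\<^esub>}"
proof -
  interpret M: left_module R M by fact
  let ?X = "submod M X" and ?E = "mod_hom R M M"
  have lX: "left_module R ?X" by (rule M.left_module_submod[OF X])
  interpret X: left_module R ?X by (rule lX)
  let ?P = "direct_power ?E ?X"
  have P: "left_module R ?P" by (rule X.left_module_direct_power)
  note XM = M.submoduleD(1)[OF X]
  \<comment> \<open>\<open>s\<close> sends a family (x_\<phi>), indexed by the endomorphisms \<phi>
    of \<open>M\<close>, to the sum of the \<phi>(x_\<phi>) over its finite support.\<close>
  define s where "s = (\<lambda>w\<in>carrier ?P. finsum M (\<lambda>\<phi>. restrict \<phi> X (w \<phi>)) {\<phi> \<in> ?E. w \<phi> \<noteq> \<zero>\<^bsub>?X\<^esub>})"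
  have r: "restrict \<phi> X \<in> mod_hom R ?X M" if "\<phi> \<in> ?E" for \<phi>
    by (rule mod_hom_restrict[OF M that X]) (use mod_homD(1)[OF that] XM in auto)
  have s: "s \<in> mod_hom R ?P M"
    unfolding s_def by (rule sum_map_hom[OF lX M r])
  define T where "T = s ` carrier ?P"
  have T: "submodule T R M" unfolding T_def by (rule submodule_image[OF P M s submodule_carrier[OF P]])
  have \<phi>T: "\<phi> x \<in> T" if \<phi>: "\<phi> \<in> ?E" and x: "x \<in> X" for \<phi> x
  proof -
    let ?w = "power_single ?E ?X \<phi> x"
    have w: "?w \<in> carrier ?P"
      using mod_homD(1)[OF power_single_hom[OF lX \<phi>], of x] x by simp
    have z: "\<phi> \<zero>\<^bsub>M\<^esub> = \<zero>\<^bsub>M\<^esub>" by (rule mod_hom_zero[OF M M \<phi>])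
    have "s ?w = finsum M (\<lambda>\<psi>. restrict \<psi> X (?w \<psi>)) {\<psi> \<in> ?E. ?w \<psi> \<noteq> \<zero>\<^bsub>?X\<^esub>}"
      using w by (simp add: s_def)
    also have "\<dots> = \<phi> x"
    \<comment> \<open>For \<open>x\<close> zero the support of \<open>?w\<close> is empty instead of
      being the singleton of \<phi>.\<close>
    proof (cases "x = \<zero>\<^bsub>M\<^esub>")
      case True
      then have "{\<psi> \<in> ?E. ?w \<psi> \<noteq> \<zero>\<^bsub>?X\<^esub>} = {}" by (auto simp: power_single_def)
      then show ?thesis using True z by (simp only: M.M.finsum_empty)
    next
      case False
      then have *: "{\<psi> \<in> ?E. ?w \<psi> \<noteq> \<zero>\<^bsub>?X\<^esub>} = {\<phi>}" using \<phi> by (auto simp: power_single_def)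
      show ?thesis unfolding *
        using \<phi> x XM mod_homD(1)[OF \<phi>] by (simp add: power_single_def subset_iff)
    qed
    finally show ?thesis unfolding T_def using w by (metis image_eqI)
  qed
  \<comment> \<open>Minimality of \<open>T\<close> reduces later claims about \<open>T\<close> to
    elements \<phi>(x) with \<open>x\<close> in \<open>X\<close>: it is applied to the preimage of
    \<open>T\<close> under an endomorphism and to the kernel of a map from \<open>M\<close> to
    \<open>T\<close>.\<close>
  have least: "T \<subseteq> H" if H: "submodule H R M" and sub: "\<And>\<phi> x. \<phi> \<in> ?E \<Longrightarrow> x \<in> X \<Longrightarrow> \<phi> x \<in> H" for H
  proof -
    have fs: "finsum M h F \<in> H" if "finite F" "\<And>i. i \<in> F \<Longrightarrow> h i \<in> H" for h :: "('m \<Rightarrow> 'm) \<Rightarrow> 'm" and F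
      using that
    proof (induction F rule: finite_induct)
      case (insert a F)
      have "h \<in> F \<rightarrow> carrier M" "h a \<in> carrier M"
        using insert.prems M.submoduleD(1)[OF H] by auto
      then show ?case using insert M.submoduleD(3)[OF H] by simp
    qed (simp add: M.submoduleD(2)[OF H])
    show ?thesis
    proof
      fix t assume "t \<in> T"
      then obtain w where w: "w \<in> carrier ?P" "t = s w" by (auto simp: T_def)
      note D = X.direct_power_memD[OF w(1)]
      have wX: "w \<phi> \<in> X" if "\<phi> \<in> ?E" for \<phi> using D(1)[OF that] by simp
      show "t \<in> H"
        unfolding w(2) s_def using w(1) D(2) sub wX by (auto intro!: fs)
    qed
  qed
  have one: "(\<lambda>x\<in>carrier M. x) \<in> ?E"
    using mod_hom_incl[OF M submodule_carrier[OF M]] by simp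
  have XT: "X \<subseteq> T"
    using \<phi>T[OF one] XM by (auto simp: subset_iff)
  have FI: "fully_invariant R M T"
    unfolding fully_invariant_def
  proof (intro conjI ballI T)
    fix f assume f: "f \<in> ?E"
    have "T \<subseteq> {x \<in> carrier M. f x \<in> T}"
    proof (rule least[OF submodule_preimage[OF M M f T]])
      fix \<phi> x assume \<phi>: "\<phi> \<in> ?E" and x: "x \<in> X"
      have "compose (carrier M) f \<phi> \<in> ?E" by (rule mod_hom_compose[OF M \<phi> f])
      from \<phi>T[OF this x] show "\<phi> x \<in> {x \<in> carrier M. f x \<in> T}"
        using x XM mod_homD(1)[OF \<phi>] by (auto simp: compose_def)
    qed
    then show "f ` T \<subseteq> T" by auto
  qed
  let ?T = "submod M T"
  have lT: "left_module R ?T" by (rule M.left_module_submod[OF T])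
  interpret P: left_module R ?P by (rule P)
  have s': "s \<in> mod_hom R ?P ?T" by (rule mod_hom_submod[OF s]) (simp add: T_def)
  let ?K = "mod_ker ?P ?T s"
  have K: "submodule ?K R ?P" by (rule submodule_ker[OF P lT s'])
  have sP: "in_sigma R M ?P" by (rule M.in_sigma_direct_power[OF X])
  have sK: "in_sigma R M (submod ?P ?K)"
    by (rule in_sigma_embed[OF M P.left_module_submod[OF K] sP mod_hom_incl[OF P K]])
      (simp add: inj_on_def)
  have ex: "short_exact R (submod ?P ?K) (\<lambda>x\<in>?K. x) ?P s ?T"
    by (rule short_exact_ker[OF P lT s']) (simp add: T_def)
  have hom_ex: "hom_exact R M (submod ?P ?K) (\<lambda>x\<in>?K. x) ?P s ?T"
    by (rule projective_any[OF M proj sK sP M.in_sigma_submodule[OF T] ex])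
  \<comment> \<open>Lift \<open>g\<close> along \<open>s\<close> to \<open>G\<close>. For
    endomorphisms \<phi> and \<psi>, applying \<phi>, then \<open>G\<close>, then the coordinate at
    \<psi> is a homomorphism from \<open>M\<close> to \<open>X\<close>, so it vanishes on
    \<open>X\<close> by \<open>ann\<close>. Hence \<open>G\<close>, and with it \<open>g\<close>,
    kills every \<phi>(X).\<close>
  have kill: "g t = \<zero>\<^bsub>M\<^esub>" if g: "g \<in> mod_hom R M ?T" and t: "t \<in> T" for g t
  proof -
    obtain G where G: "G \<in> mod_hom R M ?P" "g = compose (carrier M) s G"
      using hom_ex g unfolding hom_exact_def by blast
    have gM: "g \<in> ?E" by (rule mod_hom_submodD[OF g M.submoduleD(1)[OF T]])
    have "T \<subseteq> mod_ker M M g"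
    proof (rule least[OF submodule_ker[OF M M gM]])
      fix \<phi> x assume \<phi>: "\<phi> \<in> ?E" and x: "x \<in> X"
      have xM: "x \<in> carrier M" and \<phi>x: "\<phi> x \<in> carrier M" using x XM mod_homD(1)[OF \<phi>] by auto
      have w: "G (\<phi> x) \<in> carrier ?P" by (rule mod_homD(1)[OF G(1) \<phi>x])
      have "G (\<phi> x) \<psi> = \<zero>\<^bsub>M\<^esub>" if \<psi>: "\<psi> \<in> ?E" for \<psi>
      proof -
        have "compose (carrier M) (\<lambda>x\<in>carrier ?P. x \<psi>) (compose (carrier M) G \<phi>) \<in> mod_hom R M ?X"
          by (rule mod_hom_compose[OF M mod_hom_compose[OF M \<phi> G(1)] X.power_proj_hom[OF \<psi>]])
        from ann[OF this x] show ?thesis using xM w by (simp add: compose_apply)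
      qed
      then have *: "{\<psi> \<in> ?E. G (\<phi> x) \<psi> \<noteq> \<zero>\<^bsub>?X\<^esub>} = {}" by auto
      have "s (G (\<phi> x)) = finsum M (\<lambda>\<psi>. restrict \<psi> X (G (\<phi> x) \<psi>)) {\<psi> \<in> ?E. G (\<phi> x) \<psi> \<noteq> \<zero>\<^bsub>?X\<^esub>}"
        using w by (simp add: s_def)
      also have "\<dots> = \<zero>\<^bsub>M\<^esub>" unfolding * by simp
      finally have "s (G (\<phi> x)) = \<zero>\<^bsub>M\<^esub>" .
      then show "\<phi> x \<in> mod_ker M M g" using G(2) \<phi>x by (simp add: mod_ker_def compose_apply)
    qed
    then show ?thesis using t by (auto simp: mod_ker_def)
  qed
  have zero: "submodule {\<zero>\<^bsub>M\<^esub>} R M" by (rule M.submoduleI) auto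
  have "submod_prod R M T T \<subseteq> {\<zero>\<^bsub>M\<^esub>}"
    unfolding submod_prod_def submod_sum_def
    by (rule M.mod_span_least[OF zero]) (use kill in auto)
  moreover have "\<zero>\<^bsub>M\<^esub> \<in> submod_prod R M T T"
    unfolding submod_prod_def submod_sum_def mod_span_def using M.submoduleD(2) by blast
  ultimately have "submod_prod R M T T = {\<zero>\<^bsub>M\<^esub>}" by blast
  then have "T = {\<zero>\<^bsub>M\<^esub>}" using sp FI unfolding semiprime_module_def by blast
  then show ?thesis using XT M.submoduleD(2)[OF X] by blast
qed

section \<open>The reject of A in M\<close>

text \<open>With \<open>G\<close> all of \<open>mod_hom R M A\<close> this is the reject of
  \<open>A\<close> in \<open>M\<close>. The explicit carrier makes it all of \<open>M\<close> for
  empty \<open>G\<close>, where the induction in \<open>quasi_injective_extend\<close>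
  starts.\<close>

definition common_ker :: "('r, 'm) module \<Rightarrow> ('r, 'a) module \<Rightarrow> ('m \<Rightarrow> 'a) set \<Rightarrow> 'm set"
  where "common_ker M A G = {x \<in> carrier M. \<forall>g\<in>G. g x = \<zero>\<^bsub>A\<^esub>}"

lemma submodule_common_ker:
  assumes M: "left_module R M" and A: "left_module R A" and G: "G \<subseteq> mod_hom R M A"
  shows "submodule (common_ker M A G) R M"
proof -
  interpret M: left_module R M by fact
  interpret A: left_module R A by fact
  have g: "g \<in> mod_hom R M A" if "g \<in> G" for g using G that by blast
  show ?thesis
    unfolding common_ker_def
  proof (rule M.submoduleI; clarify)
    fix x y assume x: "x \<in> carrier M" "\<forall>h\<in>G. h x = \<zero>\<^bsub>A\<^esub>" and y: "y \<in> carrier M" "\<forall>h\<in>G. h y = \<zero>\<^bsub>A\<^esub>"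
    have "h (x \<oplus>\<^bsub>M\<^esub> y) = \<zero>\<^bsub>A\<^esub>" if "h \<in> G" for h
      using mod_homD(3)[OF g[OF that] x(1) y(1)] bspec[OF x(2) that] bspec[OF y(2) that] by simp
    then show "x \<oplus>\<^bsub>M\<^esub> y \<in> carrier M \<and> (\<forall>g\<in>G. g (x \<oplus>\<^bsub>M\<^esub> y) = \<zero>\<^bsub>A\<^esub>)"
      using x(1) y(1) by blast
  next
    fix r x assume r: "r \<in> carrier R" and x: "x \<in> carrier M" "\<forall>h\<in>G. h x = \<zero>\<^bsub>A\<^esub>"
    have "h (r \<odot>\<^bsub>M\<^esub> x) = \<zero>\<^bsub>A\<^esub>" if "h \<in> G" for h
      using mod_homD(4)[OF g[OF that] r x(1)] bspec[OF x(2) that] r by simp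
    then show "r \<odot>\<^bsub>M\<^esub> x \<in> carrier M \<and> (\<forall>g\<in>G. g (r \<odot>\<^bsub>M\<^esub> x) = \<zero>\<^bsub>A\<^esub>)"
      using r x(1) by blast
  qed (use mod_hom_zero[OF M A g] in simp)
qed

lemma hom_vanishes_on_reject:
  assumes M: "left_module R M" and proj: "projective_in_sigma R M" and sp: "semiprime_module R M"
    and A: "in_sigma R M A" and ns: "non_M_singular R M A"
    and U: "submodule U R M" and f: "f \<in> mod_hom R (submod M U) A"
    and x: "x \<in> U" "x \<in> common_ker M A (mod_hom R M A)"
  shows "f x = \<zero>\<^bsub>A\<^esub>"
proof -
  interpret M: left_module R M by fact
  have A': "left_module R A" by (rule in_sigma_left_module[OF A])
  let ?V = "U \<inter> common_ker M A (mod_hom R M A)"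
  have V: "submodule ?V R M"
    by (rule M.submodule_Int[OF U submodule_common_ker[OF M A' subset_refl]])
  note lU = M.left_module_submod[OF U]
  have fV: "restrict f ?V \<in> mod_hom R (submod M ?V) A"
    using mod_hom_restrict[OF lU f M.submodule_submodI[OF U V]] mod_homD(1)[OF f] by auto
  have "restrict f ?V x = \<zero>\<^bsub>A\<^esub>"
  proof (rule hom_vanishes_if_ker_essential[OF M A ns V fV])
    fix X assume X: "submodule X R M" "X \<subseteq> ?V"
      and inj: "\<And>x. x \<in> X \<Longrightarrow> restrict f ?V x = \<zero>\<^bsub>A\<^esub> \<Longrightarrow> x = \<zero>\<^bsub>M\<^esub>"
    \<comment> \<open>The composite of \<open>g\<close> and \<open>f\<close> is defined on all of
      \<open>M\<close>, so it kills \<open>x\<close>, which lies in the reject. As g(x) is in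
      \<open>X\<close>, where \<open>f\<close> is injective, g(x) is zero.\<close>
    have "g x = \<zero>\<^bsub>M\<^esub>" if g: "g \<in> mod_hom R M (submod M X)" and x: "x \<in> X" for g x
    proof -
      have xM: "x \<in> carrier M" using x M.submoduleD(1)[OF X(1)] by blast
      have gx: "g x \<in> X" using mod_homD(1)[OF g xM] by simp
      have "g ` carrier M \<subseteq> U" using mod_homD(1)[OF g] X(2) by auto
      then have "g \<in> mod_hom R M (submod M U)"
        using mod_hom_submod[OF mod_hom_submodD[OF g M.submoduleD(1)[OF X(1)]]] by blast
      then have "compose (carrier M) f g \<in> mod_hom R M A" by (rule mod_hom_compose[OF M _ f])
      then have "f (g x) = \<zero>\<^bsub>A\<^esub>"
        using x X(2) xM by (auto simp: common_ker_def compose_apply dest!: subsetD)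
      moreover have "g x \<in> ?V" using gx X(2) by blast
      ultimately show ?thesis using inj[OF gx] by simp
    qed
    then show "X \<subseteq> {\<zero>\<^bsub>M\<^esub>}" using semiprime_self_annihilating[OF M proj sp X(1)] by blast
  qed (use x in simp)
  then show ?thesis using x by simp
qed

section \<open>Finitely many homomorphisms cut out the reject\<close>

text \<open>
  Let \<open>V\<^sub>j\<close> be the sum of the first \<open>j\<close> uniform summands. By induction on \<open>j\<close>, some finite common kernel
  meets \<open>V\<^sub>j\<close> inside the reject. In the step, one homomorphism \<open>g\<close> that is nonzero on
  \<open>L = ker G \<inter> V\<^sub>j\<^sub>+\<^sub>1\<close> is enough: if \<open>L' = L \<inter> ker g\<close> were not contained in \<open>V\<^sub>j\<close>, its image in the
  uniform module \<open>V\<^sub>j\<^sub>+\<^sub>1/V\<^sub>j\<close> would be nonzero, so \<open>L' + (L \<inter> V\<^sub>j)\<close> would be essential in \<open>L\<close> and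
  killed by \<open>g\<close>.
\<close>

lemma finite_common_ker:
  fixes M :: "('r, 'm) module" and A :: "('r, 'a) module"
  assumes M: "left_module R M" and A: "in_sigma R M A" and ns: "non_M_singular R M A"
    and dim: "has_uniform_dim R M n"
  obtains G where "finite G" "G \<subseteq> mod_hom R M A"
    "common_ker M A G \<subseteq> common_ker M A (mod_hom R M A)"
proof -
  interpret M: left_module R M by fact
  have A': "left_module R A" by (rule in_sigma_left_module[OF A])
  interpret A: left_module R A by (rule A')
  obtain U where uni: "\<And>i. i < n \<Longrightarrow> uniform_submodule R M (U i)"
    and ind: "independent_family R M {..<n} U"
    and ess: "essential R M (submod_sum R M (U ` {..<n}))"
    using dim unfolding has_uniform_dim_def by blast
  have U: "submodule (U i) R M" if "i < n" for i
    using uni[OF that] unfolding uniform_submodule_def by blast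
  define V where "V j = submod_sum R M (U ` {..<j})" for j
  have UM: "\<Union>(U ` {..<j}) \<subseteq> carrier M" if "j \<le> n" for j
    using M.submoduleD(1)[OF U] that by (intro UN_least) simp
  have V: "submodule (V j) R M" and UV: "\<Union>(U ` {..<j}) \<subseteq> V j" if "j \<le> n" for j
    unfolding V_def submod_sum_def by (rule M.submodule_mod_span[OF UM[OF that]])+
  let ?H = "mod_hom R M A"
  let ?K = "common_ker M A ?H"
  have K: "submodule ?K R M" by (rule submodule_common_ker[OF M A' subset_refl])
  have restr: "restrict g L \<in> mod_hom R (submod M L) A" if "g \<in> ?H" "submodule L R M" for g L
    by (rule mod_hom_restrict[OF M that]) (use mod_homD(1)[OF that(1)] M.submoduleD(1)[OF that(2)] in auto)
  have "\<exists>G. finite G \<and> G \<subseteq> ?H \<and> common_ker M A G \<inter> V j \<subseteq> ?K" if "j \<le> n" for j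
    using that
  proof (induction j)
    case 0
    have "submodule {\<zero>\<^bsub>M\<^esub>} R M" by (rule M.submoduleI) auto
    then have "V 0 \<subseteq> {\<zero>\<^bsub>M\<^esub>}" unfolding V_def submod_sum_def by (intro M.mod_span_least) auto
    then show ?case using M.submoduleD(2)[OF K] by (intro exI[of _ "{}"]) auto
  next
    case (Suc j)
    then have j: "j < n" "j \<le> n" by auto
    obtain G where G: "finite G" "G \<subseteq> ?H" "common_ker M A G \<inter> V j \<subseteq> ?K"
      using Suc.IH j by blast
    note Vj = V[OF j(2)] and Uj = U[OF j(1)]
    note DV = M.submoduleD[OF Vj] and DU = M.submoduleD[OF Uj]
    have VU: "v = \<zero>\<^bsub>M\<^esub>" if "v \<in> V j" "v \<in> U j" for v
    proof -
      have sub: "\<Union>(U ` {..<j}) \<subseteq> \<Union>(U ` ({..<n} - {j}))" using j by (intro UN_mono) auto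
      have "V j \<subseteq> submod_sum R M (U ` ({..<n} - {j}))"
        unfolding V_def submod_sum_def mod_span_def using order_trans[OF sub]
        by (intro Inter_anti_mono Collect_mono) blast
      then show ?thesis using ind j(1) that unfolding independent_family_def by blast
    qed
    have VS: "V (Suc j) \<subseteq> V j <+>\<^bsub>M\<^esub> U j"
    proof -
      have "U i \<subseteq> V j <+>\<^bsub>M\<^esub> U j" if "i < Suc j" for i
      proof (cases "i = j")
        case True
        then show ?thesis using M.set_addI[OF DV(2), of _ "U j"] DU(1)
          by (auto simp: subset_iff)
      next
        case False
        then have "U i \<subseteq> V j" using UV[OF j(2)] that by fastforce
        then show ?thesis using M.set_addI[OF _ DU(2), of _ "V j"] DV(1)
          by (auto simp: subset_iff)
      qed
      then show ?thesis unfolding V_def[of "Suc j"] submod_sum_def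
        by (intro M.mod_span_least M.submodule_set_add[OF Vj Uj]) blast
    qed
    define L where "L = common_ker M A G \<inter> V (Suc j)"
    have L: "submodule L R M"
      unfolding L_def by (rule M.submodule_Int[OF submodule_common_ker[OF M A' G(2)] V[OF Suc.prems]])
    note DL = M.submoduleD[OF L]
    show ?case
    proof (cases "L \<subseteq> ?K")
      case True
      then show ?thesis using G unfolding L_def by blast
    next
      case False
      then obtain x g where xg: "x \<in> L" "g \<in> ?H" "g x \<noteq> \<zero>\<^bsub>A\<^esub>"
        using DL(1) by (auto simp: common_ker_def)
      define L' where "L' = L \<inter> mod_ker M A g"
      have L': "submodule L' R M"
        unfolding L'_def by (rule M.submodule_Int[OF L submodule_ker[OF M A' xg(2)]])
      note DL' = M.submoduleD[OF L']
      \<comment> \<open>Elements of \<open>L\<close> lie in the common kernel of \<open>G\<close>,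
        so the induction hypothesis puts those in \<open>V j\<close> into the reject.\<close>
      have LVK: "g y = \<zero>\<^bsub>A\<^esub>" if "y \<in> L" "y \<in> V j" for y
        using that G(3) xg(2) by (auto simp: L_def common_ker_def)
      have "L' \<subseteq> V j"
      proof (rule ccontr)
        assume nsub: "\<not> L' \<subseteq> V j"
        have "restrict g L x = \<zero>\<^bsub>A\<^esub>"
        proof (rule hom_vanishes_if_ker_essential[OF M A ns L restr[OF xg(2) L]])
          fix Y assume Y: "submodule Y R M" "Y \<subseteq> L"
            and inj: "\<And>x. x \<in> Y \<Longrightarrow> restrict g L x = \<zero>\<^bsub>A\<^esub> \<Longrightarrow> x = \<zero>\<^bsub>M\<^esub>"
          note DY = M.submoduleD[OF Y(1)]
          have inj: "y = \<zero>\<^bsub>M\<^esub>" if "y \<in> Y" "g y = \<zero>\<^bsub>A\<^esub>" for y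
            using inj[OF that(1)] that Y(2) by auto
          show "Y \<subseteq> {\<zero>\<^bsub>M\<^esub>}"
          proof (rule ccontr)
            assume nz: "\<not> Y \<subseteq> {\<zero>\<^bsub>M\<^esub>}"
            have YV: "\<not> Y \<subseteq> V j" using nz inj LVK Y(2) by blast
            \<comment> \<open>The quotient of \<open>V (Suc j)\<close> by \<open>V j\<close> is not
              formed: the intersection of \<open>U j\<close> with H + V_j stands for the image of
              \<open>H\<close> in it. An element of \<open>H\<close> outside \<open>V j\<close> has
              a nonzero component in \<open>U j\<close>, and that component lies in this
              intersection.\<close>
            have meet: "U j \<inter> (H <+>\<^bsub>M\<^esub> V j) \<noteq> {\<zero>\<^bsub>M\<^esub>}"
              if H: "submodule H R M" "H \<subseteq> L" "\<not> H \<subseteq> V j" for H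
            proof -
              obtain h where h: "h \<in> H" "h \<notin> V j" using H(3) by blast
              then have "h \<in> V j <+>\<^bsub>M\<^esub> U j" using H(2) VS by (auto simp: L_def)
              then obtain v u where vu: "v \<in> V j" "u \<in> U j" "h = v \<oplus>\<^bsub>M\<^esub> u" by (rule M.set_addE)
              have c: "v \<in> carrier M" "u \<in> carrier M" using vu DV(1) DU(1) by auto
              have "u = h \<oplus>\<^bsub>M\<^esub> \<ominus>\<^bsub>M\<^esub> v"
                unfolding vu(3) using c by (simp add: M.M.a_comm[of v u] M.M.a_assoc M.M.r_neg)
              then have "u \<in> H <+>\<^bsub>M\<^esub> V j" using M.set_addI[OF h(1) DV(5)[OF vu(1)]] by simp
              moreover have "u \<noteq> \<zero>\<^bsub>M\<^esub>" using h(2) vu c by auto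
              ultimately show ?thesis using vu(2) by blast
            qed
            let ?Y = "U j \<inter> (Y <+>\<^bsub>M\<^esub> V j)" and ?L = "U j \<inter> (L' <+>\<^bsub>M\<^esub> V j)"
            \<comment> \<open>Uniformity of \<open>U j\<close> gives a nonzero element
              \<open>u\<close> common to the images of \<open>Y\<close> and
              \<open>L'\<close>.\<close>
            have "?Y \<inter> ?L \<noteq> {\<zero>\<^bsub>M\<^esub>}"
              using uni[OF j(1)] meet[OF Y YV] meet[OF L' _ nsub]
                M.submodule_Int[OF Uj M.submodule_set_add[OF Y(1) Vj]]
                M.submodule_Int[OF Uj M.submodule_set_add[OF L' Vj]]
              unfolding uniform_submodule_def L'_def by blast
            moreover have "\<zero>\<^bsub>M\<^esub> \<in> ?Y \<inter> ?L"
              using M.submoduleD(2)[OF M.submodule_Int[OF Uj M.submodule_set_add[OF Y(1) Vj]]]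
                M.submoduleD(2)[OF M.submodule_Int[OF Uj M.submodule_set_add[OF L' Vj]]] by blast
            ultimately obtain u where u: "u \<in> U j" "u \<in> Y <+>\<^bsub>M\<^esub> V j" "u \<in> L' <+>\<^bsub>M\<^esub> V j" "u \<noteq> \<zero>\<^bsub>M\<^esub>"
              by blast
            obtain y v where yv: "y \<in> Y" "v \<in> V j" "u = y \<oplus>\<^bsub>M\<^esub> v" using u(2) by (rule M.set_addE)
            obtain l w where lw: "l \<in> L'" "w \<in> V j" "u = l \<oplus>\<^bsub>M\<^esub> w" using u(3) by (rule M.set_addE)
            have c: "y \<in> carrier M" "v \<in> carrier M" "l \<in> carrier M" "w \<in> carrier M"
              using yv lw DY(1) DV(1) DL'(1) by auto
            \<comment> \<open>The two decompositions of \<open>u\<close> put y - l into both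
              \<open>L\<close> and \<open>V j\<close>, so \<open>g\<close> agrees on
              \<open>y\<close> and \<open>l\<close> and is zero on both. Injectivity on
              \<open>Y\<close> gives y = 0, and then u = v lies in \<open>V j\<close> and
              \<open>U j\<close>, which meet in zero.\<close>
            have "y \<ominus>\<^bsub>M\<^esub> l = w \<ominus>\<^bsub>M\<^esub> v"
            proof -
              have "y = (y \<oplus>\<^bsub>M\<^esub> v) \<ominus>\<^bsub>M\<^esub> v"
                using c by (simp add: a_minus_def M.M.a_assoc M.M.r_neg)
              also have "\<dots> = (w \<ominus>\<^bsub>M\<^esub> v) \<oplus>\<^bsub>M\<^esub> l"
                unfolding yv(3)[symmetric] lw(3) a_minus_def using c
                by (simp add: M.M.a_assoc M.M.a_comm[of l])
              finally have y: "y = (w \<ominus>\<^bsub>M\<^esub> v) \<oplus>\<^bsub>M\<^esub> l" .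
              show ?thesis unfolding a_minus_def[of M y] using c
                by (subst y) (simp add: a_minus_def M.M.a_assoc M.M.r_neg)
            qed
            then have "y \<ominus>\<^bsub>M\<^esub> l \<in> V j" using M.a_minus_submodule[OF Vj lw(2) yv(2)] by simp
            moreover have "y \<ominus>\<^bsub>M\<^esub> l \<in> L"
              by (rule M.a_minus_submodule[OF L]) (use yv(1) Y(2) lw(1) in \<open>auto simp: L'_def\<close>)
            ultimately have "g (y \<ominus>\<^bsub>M\<^esub> l) = \<zero>\<^bsub>A\<^esub>" by (intro LVK)
            moreover have "g l = \<zero>\<^bsub>A\<^esub>" using lw(1) by (simp add: L'_def mod_ker_def)
            moreover have "y = (y \<ominus>\<^bsub>M\<^esub> l) \<oplus>\<^bsub>M\<^esub> l"
              using c by (simp add: a_minus_def M.M.a_assoc M.M.l_neg)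
            ultimately have "g y = \<zero>\<^bsub>A\<^esub>"
              using mod_homD(3)[OF xg(2), of "y \<ominus>\<^bsub>M\<^esub> l" l] c by simp
            then have "u = v" using inj[OF yv(1)] yv(3) c by simp
            then show False using VU[OF yv(2)] u(1,4) by blast
          qed
        qed (rule xg(1))
        then show False using xg by simp
      qed
      moreover have "common_ker M A (insert g G) \<inter> V (Suc j) \<subseteq> L'"
        by (auto simp: common_ker_def L'_def L_def mod_ker_def)
      \<comment> \<open>The left side lies in \<open>L'\<close>, hence in \<open>V j\<close>, and
        also in the common kernel of \<open>G\<close>; the induction hypothesis applies.\<close>
      ultimately have "common_ker M A (insert g G) \<inter> V (Suc j) \<subseteq> ?K"
        using G(3) by (auto simp: common_ker_def)
      then show ?thesis using G xg(2) by (intro exI[of _ "insert g G"]) simp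
    qed
  qed
  from this[of n] obtain G where G: "finite G" "G \<subseteq> ?H" "common_ker M A G \<inter> V n \<subseteq> ?K" by auto
  let ?N = "common_ker M A G"
  have N: "submodule ?N R M" by (rule submodule_common_ker[OF M A' G(2)])
  \<comment> \<open>\<open>V n\<close> is essential in \<open>M\<close> and meets \<open>?N\<close>
    inside the reject. So each \<open>g\<close> in \<open>?H\<close> vanishes on this intersection,
    and a submodule of \<open>?N\<close> on which \<open>g\<close> is injective meets
    \<open>V n\<close> in zero, hence is zero.\<close>
  have "?N \<subseteq> ?K"
  proof
    fix x assume x: "x \<in> ?N"
    have "g x = \<zero>\<^bsub>A\<^esub>" if g: "g \<in> ?H" for g
    proof -
      have "restrict g ?N x = \<zero>\<^bsub>A\<^esub>"
      proof (rule hom_vanishes_if_ker_essential[OF M A ns N restr[OF g N] _ x])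
        fix Y assume Y: "submodule Y R M" "Y \<subseteq> ?N"
          and inj: "\<And>x. x \<in> Y \<Longrightarrow> restrict g ?N x = \<zero>\<^bsub>A\<^esub> \<Longrightarrow> x = \<zero>\<^bsub>M\<^esub>"
        have "y = \<zero>\<^bsub>M\<^esub>" if "y \<in> Y" "y \<in> V n" for y
        proof (rule inj[OF that(1)])
          have "y \<in> ?K" using that Y(2) G(3) by blast
          then show "restrict g ?N y = \<zero>\<^bsub>A\<^esub>" using g that(1) Y(2) by (auto simp: common_ker_def)
        qed
        then have "V n \<inter> Y = {\<zero>\<^bsub>M\<^esub>}" using M.submoduleD(2)[OF Y(1)] M.submoduleD(2)[OF V[of n]] by blast
        then show "Y \<subseteq> {\<zero>\<^bsub>M\<^esub>}" using ess Y(1) unfolding essential_def V_def by blast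
      qed
      then show ?thesis using x by simp
    qed
    then show "x \<in> ?K" using x by (auto simp: common_ker_def)
  qed
  then show ?thesis using that G by blast
qed

section \<open>Extension from submodules by quasi-injectivity\<close>

text \<open>Choosing preimages under \<open>g\<close> is harmless: two preimages differ by an
  element of ker g, which \<open>f\<close> kills. The factor is defined on the image of
  \<open>g\<close> only, a submodule of \<open>B\<close>; with B = A, quasi-injectivity can then
  extend it.\<close>

lemma mod_hom_factor:
  assumes W: "left_module R W" and A: "left_module R A" and B: "left_module R B"
    and f: "f \<in> mod_hom R W A" and g: "g \<in> mod_hom R W B"
    and ker: "\<And>x. x \<in> carrier W \<Longrightarrow> g x = \<zero>\<^bsub>B\<^esub> \<Longrightarrow> f x = \<zero>\<^bsub>A\<^esub>"
  obtains \<theta> where "\<theta> \<in> mod_hom R (submod B (g ` carrier W)) A" "\<And>x. x \<in> carrier W \<Longrightarrow> \<theta> (g x) = f x"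
proof -
  interpret W: left_module R W by fact
  interpret A: left_module R A by fact
  interpret B: left_module R B by fact
  define \<theta> where "\<theta> = (\<lambda>y\<in>g ` carrier W. f (inv_into (carrier W) g y))"
  have wd: "f x = f y" if "x \<in> carrier W" "y \<in> carrier W" "g x = g y" for x y
  proof -
    have "g (x \<ominus>\<^bsub>W\<^esub> y) = \<zero>\<^bsub>B\<^esub>"
      using that mod_hom_a_minus[OF W B g that(1,2)] mod_homD(1)[OF g that(1)]
      by (simp add: a_minus_def B.M.r_neg)
    then have "f x \<ominus>\<^bsub>A\<^esub> f y = \<zero>\<^bsub>A\<^esub>"
      using ker[of "x \<ominus>\<^bsub>W\<^esub> y"] that mod_hom_a_minus[OF W A f that(1,2)] by simp
    moreover have "f x = (f x \<ominus>\<^bsub>A\<^esub> f y) \<oplus>\<^bsub>A\<^esub> f y"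
      using that by (simp add: a_minus_def A.M.a_assoc A.M.l_neg mod_homD(1)[OF f])
    ultimately show ?thesis using mod_homD(1)[OF f that(2)] by simp
  qed
  have \<theta>: "\<theta> (g x) = f x" if x: "x \<in> carrier W" for x
  proof -
    have "g x \<in> g ` carrier W" using x by simp
    then show ?thesis unfolding \<theta>_def
      using wd[OF inv_into_into[of "g x" g "carrier W"] x] f_inv_into_f[of "g x" g "carrier W"] by simp
  qed
  have "\<theta> \<in> mod_hom R (submod B (g ` carrier W)) A"
  proof (rule mod_homI)
    show "\<theta> \<in> extensional (carrier (submod B (g ` carrier W)))" by (simp add: \<theta>_def)
    show "\<theta> x \<in> carrier A" if "x \<in> carrier (submod B (g ` carrier W))" for x
      using that \<theta> mod_homD(1)[OF f] by auto
  next
    fix x y assume "x \<in> carrier (submod B (g ` carrier W))" "y \<in> carrier (submod B (g ` carrier W))"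
    then obtain a b where ab: "a \<in> carrier W" "b \<in> carrier W" "x = g a" "y = g b" by auto
    then show "\<theta> (x \<oplus>\<^bsub>submod B (g ` carrier W)\<^esub> y) = \<theta> x \<oplus>\<^bsub>A\<^esub> \<theta> y"
      using \<theta>[of "a \<oplus>\<^bsub>W\<^esub> b"] by (simp add: mod_homD(3)[OF g] mod_homD(3)[OF f] \<theta>)
  next
    fix r x assume r: "r \<in> carrier R" and "x \<in> carrier (submod B (g ` carrier W))"
    then obtain a where a: "a \<in> carrier W" "x = g a" by auto
    then show "\<theta> (r \<odot>\<^bsub>submod B (g ` carrier W)\<^esub> x) = r \<odot>\<^bsub>A\<^esub> \<theta> x"
      using r \<theta>[of "r \<odot>\<^bsub>W\<^esub> a"] by (simp add: mod_homD(4)[OF g] mod_homD(4)[OF f] \<theta>)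
  qed
  then show ?thesis using that \<theta> by blast
qed

text \<open>
  To remove \<open>g\<close> from the finite set, factor \<open>f\<close> on \<open>W = U \<inter> ker G\<close> through \<open>g\<close>, extend the factor to
  \<open>\<phi> : A \<rightarrow> A\<close>, and pass to \<open>f - \<phi> g\<close>, which vanishes on \<open>W\<close>.
\<close>

lemma quasi_injective_extend:
  assumes M: "left_module R M" and A: "left_module R A" and qi: "quasi_injective R A"
    and U: "submodule U R M"
    and G: "finite G" "G \<subseteq> mod_hom R M A"
    and f: "f \<in> mod_hom R (submod M U) A"
    and ker: "\<And>x. x \<in> U \<Longrightarrow> x \<in> common_ker M A G \<Longrightarrow> f x = \<zero>\<^bsub>A\<^esub>"
  shows "\<exists>h\<in>mod_hom R M A. \<forall>u\<in>U. h u = f u"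
  using G f ker
\<comment> \<open>\<open>f\<close> must vary, because the induction hypothesis is applied to f -
  \<phi> g.\<close>
proof (induction G arbitrary: f rule: finite_induct)
  case empty
  interpret M: left_module R M by fact
  interpret A: left_module R A by fact
  have "(\<lambda>x\<in>carrier M. \<zero>\<^bsub>A\<^esub>) \<in> mod_hom R M A" by (rule mod_homI) auto
  moreover have "f u = \<zero>\<^bsub>A\<^esub>" if "u \<in> U" for u
    using empty.prems(3)[OF that] that M.submoduleD(1)[OF U] by (auto simp: common_ker_def)
  ultimately show ?case using M.submoduleD(1)[OF U]
    by (intro bexI[of _ "\<lambda>x\<in>carrier M. \<zero>\<^bsub>A\<^esub>"]) auto
next
  case (insert g G)
  interpret M: left_module R M by fact
  interpret A: left_module R A by fact
  note UM = M.submoduleD(1)[OF U] and f = insert.prems(2)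
  have g: "g \<in> mod_hom R M A" and G: "G \<subseteq> mod_hom R M A" using insert.prems(1) by auto
  define W where "W = U \<inter> common_ker M A G"
  have W: "submodule W R M"
    unfolding W_def by (rule M.submodule_Int[OF U submodule_common_ker[OF M A G]])
  have WU: "W \<subseteq> U" by (simp add: W_def)
  have lW: "left_module R (submod M W)" by (rule M.left_module_submod[OF W])
  have lU: "left_module R (submod M U)" by (rule M.left_module_submod[OF U])
  have fW: "restrict f W \<in> mod_hom R (submod M W) A"
    using mod_hom_restrict[OF lU f M.submodule_submodI[OF U W WU], where P = A] mod_homD(1)[OF f] WU by auto
  have gW: "restrict g W \<in> mod_hom R (submod M W) A"
    by (rule mod_hom_restrict[OF M g W]) (use mod_homD(1)[OF g] WU UM in auto)
  \<comment> \<open>An element of \<open>W\<close> killed by \<open>g\<close> lies in the common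
    kernel of \<open>insert g G\<close>, where \<open>f\<close> vanishes.\<close>
  have "restrict f W x = \<zero>\<^bsub>A\<^esub>"
    if "x \<in> carrier (submod M W)" "restrict g W x = \<zero>\<^bsub>A\<^esub>" for x
    using insert.prems(3)[of x] that by (auto simp: W_def common_ker_def)
  then obtain \<theta> where \<theta>: "\<theta> \<in> mod_hom R (submod A (restrict g W ` carrier (submod M W))) A"
      "\<And>x. x \<in> carrier (submod M W) \<Longrightarrow> \<theta> (restrict g W x) = restrict f W x"
    using mod_hom_factor[OF lW A A fW gW] by metis
  have gW': "submodule (restrict g W ` carrier (submod M W)) R A"
    by (rule submodule_image[OF lW A gW submodule_carrier[OF lW]])
  obtain \<phi> where \<phi>: "\<phi> \<in> mod_hom R A A"
      "\<And>y. y \<in> restrict g W ` carrier (submod M W) \<Longrightarrow> \<phi> y = \<theta> y"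
    using qi[unfolded quasi_injective_def rel_injective_def, rule_format, OF conjI[OF gW' \<theta>(1)]]
    by metis
  have \<phi>g: "\<phi> (g x) = f x" if "x \<in> W" for x
    using \<phi>(2)[of "g x"] \<theta>(2)[of x] that by simp
  let ?c = "compose (carrier M) \<phi> g"
  have c: "?c \<in> mod_hom R M A" by (rule mod_hom_compose[OF M g \<phi>(1)])
  have cU: "restrict ?c U \<in> mod_hom R (submod M U) A"
    by (rule mod_hom_restrict[OF M c U]) (use mod_homD(1)[OF c] UM in auto)
  let ?d = "\<lambda>x\<in>carrier (submod M U). f x \<ominus>\<^bsub>A\<^esub> restrict ?c U x"
  have d: "?d \<in> mod_hom R (submod M U) A" by (rule mod_hom_minus[OF A lU f cU])
  have fc: "f x \<in> carrier A" "?c x \<in> carrier A" if "x \<in> U" for x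
    using mod_homD(1)[OF f, of x] mod_homD(1)[OF c, of x] that UM by auto
  have "?d x = \<zero>\<^bsub>A\<^esub>" if "x \<in> U" "x \<in> common_ker M A G" for x
  proof -
    have "?c x = f x" using \<phi>g[of x] that UM by (auto simp: W_def compose_apply)
    then show ?thesis using that(1) fc[OF that(1)] by (simp add: a_minus_def A.M.r_neg)
  qed
  from insert.IH[OF G d this] obtain h where h: "h \<in> mod_hom R M A" "\<And>u. u \<in> U \<Longrightarrow> h u = ?d u"
    by blast
  \<comment> \<open>\<open>h\<close> extends f - \<phi> g, so adding \<phi> g, which is already
    defined on \<open>M\<close>, extends \<open>f\<close>.\<close>
  have "(\<lambda>x\<in>carrier M. h x \<oplus>\<^bsub>A\<^esub> ?c x) \<in> mod_hom R M A"
    by (rule mod_hom_add[OF A M h(1) c])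
  moreover have "(\<lambda>x\<in>carrier M. h x \<oplus>\<^bsub>A\<^esub> ?c x) u = f u" if u: "u \<in> U" for u
  proof -
    have "(\<lambda>x\<in>carrier M. h x \<oplus>\<^bsub>A\<^esub> ?c x) u = (f u \<ominus>\<^bsub>A\<^esub> ?c u) \<oplus>\<^bsub>A\<^esub> ?c u"
      using u UM h(2)[OF u] by auto
    also have "\<dots> = f u" using fc[OF u] by (simp add: a_minus_def A.M.a_assoc A.M.l_neg)
    finally show ?thesis .
  qed
  ultimately show ?case by (intro bexI ballI)
qed

theorem theorem3p9:
  fixes R :: "('r, 'e) ring_scheme"
    and M :: "('r, 'm) module"
    and A :: "('r, 'a) module"
  assumes "ring R"
    and "left_module R M"
    and "progenerator_in_sigma R M"
    and "semiprime_module R M"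
    and "goldie_module R M"
    and "in_sigma R M A"
    and "non_M_singular R M A"
    and "quasi_injective R A"
  shows "rel_injective R M A"
proof -
  note M = assms(2) and A = assms(6,7)
  have proj: "projective_in_sigma R M" using assms(3) by (simp add: progenerator_in_sigma_def)
  obtain n where "has_uniform_dim R M n" using assms(5) by (auto simp: goldie_module_def)
  then obtain G where G: "finite G" "G \<subseteq> mod_hom R M A"
      "common_ker M A G \<subseteq> common_ker M A (mod_hom R M A)"
    using finite_common_ker[OF M A] by metis
  show ?thesis
    unfolding rel_injective_def
  proof (intro allI impI, elim conjE)
    fix U f assume U: "submodule U R M" and f: "f \<in> mod_hom R (submod M U) A"
    \<comment> \<open>The kernel condition holds because the common kernel of \<open>G\<close> lies
      in the reject, on which \<open>f\<close> vanishes.\<close>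
    show "\<exists>g\<in>mod_hom R M A. \<forall>u\<in>U. g u = f u"
      by (rule quasi_injective_extend[OF M in_sigma_left_module[OF A(1)] assms(8) U G(1,2) f])
        (use hom_vanishes_on_reject[OF M proj assms(4) A U f] G(3) in blast)
  qed
qed

end
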